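(* Let $T=(\Sigma,E)$ be a graded nominal theory, let $n\le\omega$, and let $X$ be a nominal set. Let $FX$ be the $(\Sigma,n)$-algebra with carriers $(FX)_i=\mathsf{Term}_{\Sigma,i}(X)/{\sim}$ (for $i\le n$, resp. $i<\omega$ if $n=\omega$), where $\sim$ is derivable equality in $T$ (i.e. $t\sim u$ iff $X\vdash_i t=u$ is derivable, with class $[t]_i$), and operations $f_{FX,m}([t_1]_m,\dots,[t_p]_m)=[f(t_1,\dots,t_p)]_{m+d(f)}$ for $f\in\Sigma_0$, $f_{FX,m}(a,[t_1]_m,\dots,[t_p]_m)=[a.f(t_1,\dots,t_p)]_{m+d(f)}$ for $f\in\Sigma_{\mathsf f}$, $f_{FX,m}(\langle a\rangle([t_1]_m,\dots,[t_p]_m))=[\nu a.f(t_1,\dots,t_p)]_{m+d(f)}$ for $f\in\Sigma_{\mathsf b}$, and let $\eta\colon X\to(FX)_0$, $\eta(x)=[x]_0$. Then $FX$ is a $(T,n)$-model, and it is free over $X$ with universal arrow $\eta$: for every $(T,n)$-model $A$ and every equivariant map $g\colon X\to A_0$ there is a unique homomorphism $h\colon FX\to A$ of $(\Sigma,n)$-algebras with $h_0\circ\eta=g$.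
   Context: Nominal sets: fix a countably infinite set $\mathbb{A}$ of names and let $G$ be the group of finite permutations of $\mathbb{A}$; $(a\,b)$ is the transposition of $a,b$. A nominal set is a set $X$ with a left $G$-action such that every $x$ has a finite support (a finite $S\subseteq\mathbb{A}$ such that $\pi\cdot x=x$ for every $\pi$ fixing $S$ pointwise); $\mathsf{supp}(x)$ is the least support, $a\# x$ means $a\notin\mathsf{supp}(x)$. Equivariant maps satisfy $f(\pi\cdot x)=\pi\cdot f(x)$. Orbit-finite = finitely many orbits. $\mathbb{A}$ is nominal via $\pi\cdot a=\pi(a)$; products carry the componentwise action. $[\mathbb{A}]X$ is the quotient of $\mathbb{A}\times X$ by $(a,x)\sim(b,y)$ iff $(c\,a)\cdot x=(c\,b)\cdot y$ for some $c$ fresh for $a,b,x,y$; classes are written $\langle a\rangle x$ and $\pi\cdot\langle a\rangle x=\langle\pi(a)\rangle(\pi\cdot x)$. Signatures and terms: a nominal graded signature $\Sigma$ is a disjoint union of sets $\Sigma_0$ (pure), $\Sigma_{\mathsf f}$ (free), $\Sigma_{\mathsf b}$ (bound) of operations, each with an arity $\mathsf{ar}(f)\in\mathbb{N}$ and a depth $d(f)\in\mathbb{N}$. Terms over a nominal set $X$: $t::=x\mid f(t_1,..,t_p)\mid a.g(t_1,..,t_p)\mid\nu a.h(t_1,..,t_p)$ ($x\in X$, $a\in\mathbb{A}$, $f\in\Sigma_0,g\in\Sigma_{\mathsf f},h\in\Sigma_{\mathsf b}$ of arity $p$); write $\eta.f(\vec t)$ generically with prefix $\eta$ empty, $a$ or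 $\nu a$. Variables have uniform depth $0$; $\eta.f(t_1,..,t_p)$ has uniform depth $m+d(f)$ if all $t_i$ have uniform depth $m$. $\mathsf{Term}_{\Sigma,m}(X)$ is the set of terms of uniform depth $m$, a nominal set under $\pi\cdot f(\vec t)=f(\pi\cdot\vec t)$, $\pi\cdot a.g(\vec t)=\pi(a).g(\pi\cdot\vec t)$, $\pi\cdot\nu a.h(\vec t)=\nu\pi(a).h(\pi\cdot\vec t)$. A substitution $\sigma\colon Y\to\mathsf{Term}_{\Sigma,l}(X)$ acts by $t\mapsto t\sigma$, replacing variables without renaming bound names. Theories and derivations: a depth-$n$ equation $X\vdash_n t=u$ has $X$ orbit-finite and $t,u\in\mathsf{Term}_{\Sigma,n}(X)$; a graded theory is $T=(\Sigma,E)$ with $E$ a set of equations (axioms). Derivable judgements $X\vdash_m t=u$ ($X$ any nominal set) are the least set closed under: (refl) $X\vdash_0x=x$; (symm); (trans); (cong) from $X\vdash_m t_i=u_i$ for all $i$ infer $X\vdash_{m+d(f)}\eta.f(\vec t)=\eta.f(\vec u)$; (ax) for an axiom $Y\vdash_m r=s$, $\tau\in G$ and $\sigma\colon Y\to\mathsf{Term}_{\Sigma,l}(X)$ with $X\vdash_l\pi\cdot\sigma(y)=\sigma(\pi\cdot y)$ derivable for all $\pi\in G,y\in Y$, infer $X\vdash_{m+l}(\tau\cdot r)\sigma=(\tau\cdot s)\sigma$; (perm) for $h\in\Sigma_{\mathsf b}$, names $a\neq b$ with $a\# u_i$ for all $i$, from $X\vdash_m t_i=(a\,b)\cdot u_i$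 for all $i$ infer $X\vdash_{m+d(h)}\nu a.h(\vec t)=\nu b.h(\vec u)$. Algebras: for $n\le\omega$, a $(\Sigma,n)$-algebra $A$ has nominal sets $A_i$ ($0\le i\le n$; $i<\omega$ if $n=\omega$) and for $f\in\Sigma$ of arity $p$ and $m+d(f)\le n$ equivariant maps $f_{A,m}$ of type $A_m^p\to A_{m+d(f)}$ ($\Sigma_0$), $\mathbb{A}\times A_m^p\to A_{m+d(f)}$ ($\Sigma_{\mathsf f}$), $[\mathbb{A}](A_m^p)\to A_{m+d(f)}$ ($\Sigma_{\mathsf b}$). A homomorphism $h\colon A\to B$ is a family of equivariant maps $h_i\colon A_i\to B_i$ with $h_{m+d(f)}(f_{A,m}(\vec x))=f_{B,m}(h_m(\vec x))$, $h_{m+d(f)}(f_{A,m}(a,\vec x))=f_{B,m}(a,h_m(\vec x))$, $h_{m+d(f)}(f_{A,m}(\langle a\rangle\vec x))=f_{B,m}(\langle a\rangle h_m(\vec x))$ in the three cases. For an equivariant valuation $\iota\colon X\to A_k$ and $t\in\mathsf{Term}_{\Sigma,m}(X)$, $k+m\le n$, the value $[\![t]\!]^\iota_m\in A_{k+m}$ is: $[\![x]\!]^\iota_0=\iota(x)$, $[\![f(\vec t)]\!]^\iota_{m+d(f)}=f_{A,k+m}([\![\vec t]\!]^\iota_m)$, $[\![a.f(\vec t)]\!]^\iota_{m+d(f)}=f_{A,k+m}(a,[\![\vec t]\!]^\iota_m)$, $[\![\nu a.f(\vec t)]\!]^\iota_{m+d(f)}=f_{A,k+m}(\langle a\rangle[\![\vec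 t]\!]^\iota_m)$. $A$ satisfies $X\vdash_m t=u$ if $[\![t]\!]^\iota_m=[\![u]\!]^\iota_m$ for all $k$ with $k+m\le n$ and all equivariant $\iota\colon X\to A_k$. A $(T,n)$-model is a $(\Sigma,n)$-algebra satisfying all axioms in $E$. *)

theory Defs
  imports Main "HOL-Combinatorics.Perm" "HOL-Library.Extended_Nat" "HOL-Library.Countable"
    "HOL-Library.Infinite_Typeclass"
begin

section \<open>Nominal sets\<close>

text \<open>The names are the elements of a type \<open>'a\<close>, assumed countable and infinite in the theorem;
  the group of finite permutations is the type \<open>'a perm\<close>. Actions and maps are relevant only on
  carriers.\<close>

record ('a, 'x) nomset =
  car :: "'x set"
  act :: "'a perm \<Rightarrow> 'x \<Rightarrow> 'x"

definition supports :: "('a, 'x) nomset \<Rightarrow> 'a set \<Rightarrow> 'x \<Rightarrow> bool" where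
  "supports X S x \<longleftrightarrow> (\<forall>\<pi>. (\<forall>a\<in>S. Perm.apply \<pi> a = a) \<longrightarrow> act X \<pi> x = x)"

definition nominal_set :: "('a, 'x) nomset \<Rightarrow> bool" where
  "nominal_set X \<longleftrightarrow>
     (\<forall>\<pi>. \<forall>x\<in>car X. act X \<pi> x \<in> car X) \<and>
     (\<forall>x\<in>car X. act X 1 x = x) \<and>
     (\<forall>\<pi> \<rho>. \<forall>x\<in>car X. act X (\<pi> * \<rho>) x = act X \<pi> (act X \<rho> x)) \<and>
     (\<forall>x\<in>car X. \<exists>S. finite S \<and> supports X S x)"

definition supp :: "('a, 'x) nomset \<Rightarrow> 'x \<Rightarrow> 'a set" where
  "supp X x = (LEAST S. finite S \<and> supports X S x)"

definition fresh :: "('a, 'x) nomset \<Rightarrow> 'a \<Rightarrow> 'x \<Rightarrow> bool" where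
  "fresh X a x \<longleftrightarrow> a \<notin> supp X x"

definition equivariant :: "('a, 'x) nomset \<Rightarrow> ('a, 'y) nomset \<Rightarrow> ('x \<Rightarrow> 'y) \<Rightarrow> bool" where
  "equivariant X Y f \<longleftrightarrow>
     (\<forall>x\<in>car X. f x \<in> car Y) \<and> (\<forall>\<pi>. \<forall>x\<in>car X. f (act X \<pi> x) = act Y \<pi> (f x))"

definition nom_orbit :: "('a, 'x) nomset \<Rightarrow> 'x \<Rightarrow> 'x set" where
  "nom_orbit X x = range (\<lambda>\<pi>. act X \<pi> x)"

definition orbit_finite :: "('a, 'x) nomset \<Rightarrow> bool" where
  "orbit_finite X \<longleftrightarrow> finite (nom_orbit X ` car X)"

definition names :: "('a, 'a) nomset" where
  "names = \<lparr>car = UNIV, act = Perm.apply\<rparr>"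

definition prod_nom :: "('a, 'x) nomset \<Rightarrow> ('a, 'y) nomset \<Rightarrow> ('a, 'x \<times> 'y) nomset" where
  "prod_nom X Y = \<lparr>car = car X \<times> car Y, act = (\<lambda>\<pi>. map_prod (act X \<pi>) (act Y \<pi>))\<rparr>"

text \<open>\<open>p\<close>-tuples are lists of length \<open>p\<close>.\<close>

definition pow_nom :: "nat \<Rightarrow> ('a, 'x) nomset \<Rightarrow> ('a, 'x list) nomset" where
  "pow_nom p X = \<lparr>car = {xs. length xs = p \<and> set xs \<subseteq> car X}, act = (\<lambda>\<pi>. map (act X \<pi>))\<rparr>"

definition abs_rel :: "('a, 'x) nomset \<Rightarrow> (('a \<times> 'x) \<times> ('a \<times> 'x)) set" where
  "abs_rel X = {((a, x), (b, y)). x \<in> car X \<and> y \<in> car X \<and>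
     (\<exists>c. fresh names c a \<and> fresh names c b \<and> fresh X c x \<and> fresh X c y \<and>
          act X (Perm.swap c a) x = act X (Perm.swap c b) y)}"

definition abs_class :: "('a, 'x) nomset \<Rightarrow> 'a \<Rightarrow> 'x \<Rightarrow> ('a \<times> 'x) set" where
  "abs_class X a x = abs_rel X `` {(a, x)}"

text \<open>The elementwise image of the class of \<open>(a, x)\<close> under a permutation \<open>\<pi>\<close> is the class of
  \<open>(\<pi> a, \<pi> x)\<close>, since the relation is equivariant.\<close>

definition abs_nom :: "('a, 'x) nomset \<Rightarrow> ('a, ('a \<times> 'x) set) nomset" where
  "abs_nom X = \<lparr>car = car (prod_nom names X) // abs_rel X,
                act = (\<lambda>\<pi> C. act (prod_nom names X) \<pi> ` C)\<rparr>"

section \<open>Graded signatures and terms\<close>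

record 'f signature =
  pure_ops :: "'f set"
  free_ops :: "'f set"
  bound_ops :: "'f set"
  arity :: "'f \<Rightarrow> nat"
  depth :: "'f \<Rightarrow> nat"

definition is_signature :: "'f signature \<Rightarrow> bool" where
  "is_signature \<Sigma> \<longleftrightarrow> pure_ops \<Sigma> \<inter> free_ops \<Sigma> = {} \<and> pure_ops \<Sigma> \<inter> bound_ops \<Sigma> = {} \<and>
     free_ops \<Sigma> \<inter> bound_ops \<Sigma> = {}"

text \<open>The raw term \<open>App \<eta> f ts\<close> stands for \<open>\<eta>.f(ts)\<close>, where the prefix \<open>\<eta>\<close> is empty, a name
  or a binder.\<close>

datatype 'a pfx = NoPfx | Name 'a | Nu 'a

datatype ('a, 'f, 'x) trm = Var 'x | App "'a pfx" 'f "('a, 'f, 'x) trm list"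

fun op_pfx :: "'f signature \<Rightarrow> 'a pfx \<Rightarrow> 'f \<Rightarrow> bool" where
  "op_pfx \<Sigma> NoPfx f \<longleftrightarrow> f \<in> pure_ops \<Sigma>"
| "op_pfx \<Sigma> (Name a) f \<longleftrightarrow> f \<in> free_ops \<Sigma>"
| "op_pfx \<Sigma> (Nu a) f \<longleftrightarrow> f \<in> bound_ops \<Sigma>"

inductive_set terms :: "'f signature \<Rightarrow> 'x set \<Rightarrow> ('a, 'f, 'x) trm set"
  for \<Sigma> :: "'f signature" and V :: "'x set" where
  "x \<in> V \<Longrightarrow> Var x \<in> terms \<Sigma> V"
| "op_pfx \<Sigma> \<eta> f \<Longrightarrow> length ts = arity \<Sigma> f \<Longrightarrow> (\<forall>t\<in>set ts. t \<in> terms \<Sigma> V) \<Longrightarrow>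
     App \<eta> f ts \<in> terms \<Sigma> V"

text \<open>Uniform depth is a relation: a constant \<open>f\<close> has every uniform depth \<open>m + depth \<Sigma> f\<close>.\<close>

inductive uniform_depth :: "'f signature \<Rightarrow> nat \<Rightarrow> ('a, 'f, 'x) trm \<Rightarrow> bool"
  for \<Sigma> :: "'f signature" where
  "uniform_depth \<Sigma> 0 (Var x)"
| "(\<forall>t\<in>set ts. uniform_depth \<Sigma> m t) \<Longrightarrow> uniform_depth \<Sigma> (m + depth \<Sigma> f) (App \<eta> f ts)"

primrec pfx_act :: "'a perm \<Rightarrow> 'a pfx \<Rightarrow> 'a pfx" where
  "pfx_act \<pi> NoPfx = NoPfx"
| "pfx_act \<pi> (Name a) = Name (Perm.apply \<pi> a)"
| "pfx_act \<pi> (Nu a) = Nu (Perm.apply \<pi> a)"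

primrec trm_act :: "('a, 'x) nomset \<Rightarrow> 'a perm \<Rightarrow> ('a, 'f, 'x) trm \<Rightarrow> ('a, 'f, 'x) trm" where
  "trm_act X \<pi> (Var x) = Var (act X \<pi> x)"
| "trm_act X \<pi> (App \<eta> f ts) = App (pfx_act \<pi> \<eta>) f (map (trm_act X \<pi>) ts)"

definition Term :: "'f signature \<Rightarrow> nat \<Rightarrow> ('a, 'x) nomset \<Rightarrow> ('a, ('a, 'f, 'x) trm) nomset" where
  "Term \<Sigma> m X = \<lparr>car = {t \<in> terms \<Sigma> (car X). uniform_depth \<Sigma> m t}, act = trm_act X\<rparr>"

primrec subst :: "('y \<Rightarrow> ('a, 'f, 'x) trm) \<Rightarrow> ('a, 'f, 'y) trm \<Rightarrow> ('a, 'f, 'x) trm" where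
  "subst \<sigma> (Var y) = \<sigma> y"
| "subst \<sigma> (App \<eta> f ts) = App \<eta> f (map (subst \<sigma>) ts)"

section \<open>Theories and derivations\<close>

record ('a, 'f, 'y) equation =
  eq_ctx :: "('a, 'y) nomset"
  eq_depth :: nat
  eq_lhs :: "('a, 'f, 'y) trm"
  eq_rhs :: "('a, 'f, 'y) trm"

text \<open>All axioms draw their variables from one type \<open>'y\<close>, each with its own carrier and action;
  this is no restriction, as orbit-finite nominal sets are countable.\<close>

record ('a, 'f, 'y) graded_theory =
  Sig :: "'f signature"
  Axs :: "('a, 'f, 'y) equation set"

definition is_equation :: "'f signature \<Rightarrow> ('a, 'f, 'y) equation \<Rightarrow> bool" where
  "is_equation \<Sigma> e \<longleftrightarrow> nominal_set (eq_ctx e) \<and> orbit_finite (eq_ctx e) \<and>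
     eq_lhs e \<in> car (Term \<Sigma> (eq_depth e) (eq_ctx e)) \<and>
     eq_rhs e \<in> car (Term \<Sigma> (eq_depth e) (eq_ctx e))"

definition is_graded_theory :: "('a, 'f, 'y) graded_theory \<Rightarrow> bool" where
  "is_graded_theory T \<longleftrightarrow> is_signature (Sig T) \<and> (\<forall>e\<in>Axs T. is_equation (Sig T) e)"

text \<open>The context \<open>X\<close> is constant throughout a derivation. In \<open>perm\<close> the membership of \<open>us\<close> is
  explicit because actions are unconstrained outside carriers; freshness there is with respect to
  raw terms, whose support includes the bound names.\<close>

inductive derivable ::
  "('a, 'f, 'y) graded_theory \<Rightarrow> ('a, 'x) nomset \<Rightarrow> nat \<Rightarrow>
   ('a, 'f, 'x) trm \<Rightarrow> ('a, 'f, 'x) trm \<Rightarrow> bool"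
  for T :: "('a, 'f, 'y) graded_theory" and X :: "('a, 'x) nomset" where
  refl: "x \<in> car X \<Longrightarrow> derivable T X 0 (Var x) (Var x)"
| symm: "derivable T X m t u \<Longrightarrow> derivable T X m u t"
| trans: "derivable T X m t u \<Longrightarrow> derivable T X m u v \<Longrightarrow> derivable T X m t v"
| cong: "op_pfx (Sig T) \<eta> f \<Longrightarrow> length ts = arity (Sig T) f \<Longrightarrow> list_all2 (derivable T X m) ts us \<Longrightarrow>
    derivable T X (m + depth (Sig T) f) (App \<eta> f ts) (App \<eta> f us)"
| ax: "e \<in> Axs T \<Longrightarrow>
    (\<forall>y\<in>car (eq_ctx e). \<sigma> y \<in> car (Term (Sig T) l X)) \<Longrightarrow>
    (\<forall>\<pi>. \<forall>y\<in>car (eq_ctx e). derivable T X l (trm_act X \<pi> (\<sigma> y)) (\<sigma> (act (eq_ctx e) \<pi> y))) \<Longrightarrow>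
    derivable T X (eq_depth e + l)
      (subst \<sigma> (trm_act (eq_ctx e) \<tau> (eq_lhs e))) (subst \<sigma> (trm_act (eq_ctx e) \<tau> (eq_rhs e)))"
| perm: "h \<in> bound_ops (Sig T) \<Longrightarrow> length ts = arity (Sig T) h \<Longrightarrow> a \<noteq> b \<Longrightarrow>
    (\<forall>u\<in>set us. u \<in> car (Term (Sig T) m X) \<and> fresh (Term (Sig T) m X) a u) \<Longrightarrow>
    list_all2 (\<lambda>t u. derivable T X m t (trm_act X (Perm.swap a b) u)) ts us \<Longrightarrow>
    derivable T X (m + depth (Sig T) h) (App (Nu a) h ts) (App (Nu b) h us)"

section \<open>Algebras and models\<close>

text \<open>Only levels \<open>i \<le> n\<close> of an algebra record are relevant for \<open>(\<Sigma>, n)\<close>-algebras; the case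
  \<open>n = \<omega>\<close> is \<open>n = \<infinity>\<close> in \<open>enat\<close>.\<close>

record ('a, 'f, 'c) algebra =
  lev :: "nat \<Rightarrow> ('a, 'c) nomset"
  pure_op :: "'f \<Rightarrow> nat \<Rightarrow> 'c list \<Rightarrow> 'c"
  free_op :: "'f \<Rightarrow> nat \<Rightarrow> 'a \<times> 'c list \<Rightarrow> 'c"
  bound_op :: "'f \<Rightarrow> nat \<Rightarrow> ('a \<times> 'c list) set \<Rightarrow> 'c"

definition is_algebra :: "'f signature \<Rightarrow> enat \<Rightarrow> ('a, 'f, 'c) algebra \<Rightarrow> bool" where
  "is_algebra \<Sigma> n A \<longleftrightarrow>
     (\<forall>i. enat i \<le> n \<longrightarrow> nominal_set (lev A i)) \<and>
     (\<forall>f\<in>pure_ops \<Sigma>. \<forall>m. enat (m + depth \<Sigma> f) \<le> n \<longrightarrow>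
        equivariant (pow_nom (arity \<Sigma> f) (lev A m)) (lev A (m + depth \<Sigma> f)) (pure_op A f m)) \<and>
     (\<forall>f\<in>free_ops \<Sigma>. \<forall>m. enat (m + depth \<Sigma> f) \<le> n \<longrightarrow>
        equivariant (prod_nom names (pow_nom (arity \<Sigma> f) (lev A m))) (lev A (m + depth \<Sigma> f))
          (free_op A f m)) \<and>
     (\<forall>f\<in>bound_ops \<Sigma>. \<forall>m. enat (m + depth \<Sigma> f) \<le> n \<longrightarrow>
        equivariant (abs_nom (pow_nom (arity \<Sigma> f) (lev A m))) (lev A (m + depth \<Sigma> f))
          (bound_op A f m))"

definition is_hom :: "'f signature \<Rightarrow> enat \<Rightarrow> ('a, 'f, 'c) algebra \<Rightarrow> ('a, 'f, 'd) algebra \<Rightarrow>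
    (nat \<Rightarrow> 'c \<Rightarrow> 'd) \<Rightarrow> bool" where
  "is_hom \<Sigma> n A B h \<longleftrightarrow>
     (\<forall>i. enat i \<le> n \<longrightarrow> equivariant (lev A i) (lev B i) (h i)) \<and>
     (\<forall>f\<in>pure_ops \<Sigma>. \<forall>m. enat (m + depth \<Sigma> f) \<le> n \<longrightarrow>
        (\<forall>xs\<in>car (pow_nom (arity \<Sigma> f) (lev A m)).
           h (m + depth \<Sigma> f) (pure_op A f m xs) = pure_op B f m (map (h m) xs))) \<and>
     (\<forall>f\<in>free_ops \<Sigma>. \<forall>m. enat (m + depth \<Sigma> f) \<le> n \<longrightarrow>
        (\<forall>a. \<forall>xs\<in>car (pow_nom (arity \<Sigma> f) (lev A m)).
           h (m + depth \<Sigma> f) (free_op A f m (a, xs)) = free_op B f m (a, map (h m) xs))) \<and>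
     (\<forall>f\<in>bound_ops \<Sigma>. \<forall>m. enat (m + depth \<Sigma> f) \<le> n \<longrightarrow>
        (\<forall>a. \<forall>xs\<in>car (pow_nom (arity \<Sigma> f) (lev A m)).
           h (m + depth \<Sigma> f) (bound_op A f m (abs_class (pow_nom (arity \<Sigma> f) (lev A m)) a xs)) =
           bound_op B f m (abs_class (pow_nom (arity \<Sigma> f) (lev B m)) a (map (h m) xs))))"

definition apply_op :: "'f signature \<Rightarrow> ('a, 'f, 'c) algebra \<Rightarrow> 'a pfx \<Rightarrow> 'f \<Rightarrow> nat \<Rightarrow> 'c list \<Rightarrow> 'c" where
  "apply_op \<Sigma> A \<eta> f m xs =
     (case \<eta> of
        NoPfx \<Rightarrow> pure_op A f m xs
      | Name a \<Rightarrow> free_op A f m (a, xs)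
      | Nu a \<Rightarrow> bound_op A f m (abs_class (pow_nom (arity \<Sigma> f) (lev A m)) a xs))"

text \<open>\<open>eval \<Sigma> A k \<iota> t m\<close> is the value of \<open>t\<close>, taken as a term of uniform depth \<open>m\<close>, under a
  valuation \<open>\<iota>\<close> in level \<open>k\<close>. The depth is an argument because constants have several; the
  subtraction is exact on terms of uniform depth \<open>m\<close>.\<close>

primrec eval :: "'f signature \<Rightarrow> ('a, 'f, 'c) algebra \<Rightarrow> nat \<Rightarrow> ('x \<Rightarrow> 'c) \<Rightarrow>
    ('a, 'f, 'x) trm \<Rightarrow> nat \<Rightarrow> 'c" where
  "eval \<Sigma> A k \<iota> (Var x) = (\<lambda>m. \<iota> x)"
| "eval \<Sigma> A k \<iota> (App \<eta> f ts) = (\<lambda>m. apply_op \<Sigma> A \<eta> f (k + (m - depth \<Sigma> f))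
     (map (\<lambda>v. v (m - depth \<Sigma> f)) (map (eval \<Sigma> A k \<iota>) ts)))"

definition satisfies :: "'f signature \<Rightarrow> enat \<Rightarrow> ('a, 'f, 'c) algebra \<Rightarrow> ('a, 'f, 'y) equation \<Rightarrow> bool" where
  "satisfies \<Sigma> n A e \<longleftrightarrow>
     (\<forall>k \<iota>. enat (k + eq_depth e) \<le> n \<longrightarrow> equivariant (eq_ctx e) (lev A k) \<iota> \<longrightarrow>
        eval \<Sigma> A k \<iota> (eq_lhs e) (eq_depth e) = eval \<Sigma> A k \<iota> (eq_rhs e) (eq_depth e))"

definition is_model :: "('a, 'f, 'y) graded_theory \<Rightarrow> enat \<Rightarrow> ('a, 'f, 'c) algebra \<Rightarrow> bool" where
  "is_model T n A \<longleftrightarrow> is_algebra (Sig T) n A \<and> (\<forall>e\<in>Axs T. satisfies (Sig T) n A e)"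

section \<open>The term model\<close>

definition der_rel :: "('a, 'f, 'y) graded_theory \<Rightarrow> ('a, 'x) nomset \<Rightarrow> nat \<Rightarrow>
    (('a, 'f, 'x) trm \<times> ('a, 'f, 'x) trm) set" where
  "der_rel T X i = {(t, u). derivable T X i t u}"

definition cls :: "('a, 'f, 'y) graded_theory \<Rightarrow> ('a, 'x) nomset \<Rightarrow> nat \<Rightarrow>
    ('a, 'f, 'x) trm \<Rightarrow> ('a, 'f, 'x) trm set" where
  "cls T X i t = der_rel T X i `` {t}"

text \<open>Each operation is the map whose graph is given by representatives; that it is well defined
  is part of the theorem. The action on classes is the elementwise image, which sends the class of
  \<open>t\<close> to the class of \<open>\<pi> t\<close>, as derivability is equivariant.\<close>

definition free_model :: "('a, 'f, 'y) graded_theory \<Rightarrow> ('a, 'x) nomset \<Rightarrow>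
    ('a, 'f, ('a, 'f, 'x) trm set) algebra" where
  "free_model T X =
     (let \<Sigma> = Sig T;
          L = (\<lambda>i. \<lparr>car = car (Term \<Sigma> i X) // der_rel T X i, act = (\<lambda>\<pi> C. trm_act X \<pi> ` C)\<rparr>)
      in \<lparr>lev = L,
          pure_op = (\<lambda>f m Cs. THE C. \<exists>ts\<in>car (pow_nom (arity \<Sigma> f) (Term \<Sigma> m X)).
             Cs = map (cls T X m) ts \<and> C = cls T X (m + depth \<Sigma> f) (App NoPfx f ts)),
          free_op = (\<lambda>f m z. THE C. \<exists>a. \<exists>ts\<in>car (pow_nom (arity \<Sigma> f) (Term \<Sigma> m X)).
             z = (a, map (cls T X m) ts) \<and> C = cls T X (m + depth \<Sigma> f) (App (Name a) f ts)),
          bound_op = (\<lambda>f m z. THE C. \<exists>a. \<exists>ts\<in>car (pow_nom (arity \<Sigma> f) (Term \<Sigma> m X)).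
             z = abs_class (pow_nom (arity \<Sigma> f) (L m)) a (map (cls T X m) ts) \<and>
             C = cls T X (m + depth \<Sigma> f) (App (Nu a) f ts))\<rparr>)"

definition unit_map :: "('a, 'f, 'y) graded_theory \<Rightarrow> ('a, 'x) nomset \<Rightarrow> 'x \<Rightarrow> ('a, 'f, 'x) trm set" where
  "unit_map T X x = cls T X 0 (Var x)"

definition represented_ops :: "('a, 'f, 'y) graded_theory \<Rightarrow> enat \<Rightarrow> ('a, 'x) nomset \<Rightarrow>
    ('a, 'f, ('a, 'f, 'x) trm set) algebra \<Rightarrow> bool" where
  "represented_ops T n X F \<longleftrightarrow>
     (\<forall>f m ts. enat (m + depth (Sig T) f) \<le> n \<longrightarrow>
        ts \<in> car (pow_nom (arity (Sig T) f) (Term (Sig T) m X)) \<longrightarrow>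
        (f \<in> pure_ops (Sig T) \<longrightarrow>
           pure_op F f m (map (cls T X m) ts) =
             cls T X (m + depth (Sig T) f) (App NoPfx f ts)) \<and>
        (f \<in> free_ops (Sig T) \<longrightarrow> (\<forall>a.
           free_op F f m (a, map (cls T X m) ts) =
             cls T X (m + depth (Sig T) f) (App (Name a) f ts))) \<and>
        (f \<in> bound_ops (Sig T) \<longrightarrow> (\<forall>a.
           bound_op F f m (abs_class (pow_nom (arity (Sig T) f) (lev F m)) a (map (cls T X m) ts)) =
             cls T X (m + depth (Sig T) f) (App (Nu a) f ts))))"

end

theory Submission
  imports Defs
begin

text \<open>Derivable equality is an equivariant congruence, so the quotient of the terms is an algebra.
  The only delicate point is that the bound operations are well defined on abstractions of tuples of
  classes: a name that is fresh for the classes need not be fresh for the chosen representatives,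
  but the witness of an equality of abstractions may be replaced by one that is fresh for both, and
  then the rule \<open>perm\<close> applies. An axiom holds in the quotient because choosing representatives
  turns an equivariant valuation into a substitution that is equivariant up to derivable equality,
  which is what the rule \<open>ax\<close> asks for. Conversely, derivations are sound for evaluation in every
  model, hence evaluation factors through the quotient; it is the required homomorphism, and a
  homomorphism is determined on terms by its values on the variables.\<close>

unbundle permutation_syntax

section \<open>Permutations and the conjugation of transpositions\<close>

lemma perm_swap_left_commute: "\<pi> * \<langle>a \<leftrightarrow> b\<rangle> = \<langle>\<pi> \<langle>$\<rangle> a \<leftrightarrow> \<pi> \<langle>$\<rangle> b\<rangle> * \<pi>"
proof (rule perm_eqI)
  fix c
  show "(\<pi> * \<langle>a \<leftrightarrow> b\<rangle>) \<langle>$\<rangle> c = (\<langle>\<pi> \<langle>$\<rangle> a \<leftrightarrow> \<pi> \<langle>$\<rangle> b\<rangle> * \<pi>) \<langle>$\<rangle> c"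
    by (cases "c = a"; cases "c = b") (auto simp: apply_times apply_inj)
qed

lemma apply_inverse_apply [simp]: "inverse \<pi> \<langle>$\<rangle> (\<pi> \<langle>$\<rangle> a) = a" "\<pi> \<langle>$\<rangle> (inverse \<pi> \<langle>$\<rangle> a) = a"
  by (simp_all add: apply_sequence)

section \<open>Supports\<close>

lemma nominal_setD:
  assumes "nominal_set X" and "x \<in> car X"
  shows act_in_car: "act X \<pi> x \<in> car X"
    and act_one: "act X 1 x = x"
    and act_times: "act X (\<pi> * \<rho>) x = act X \<pi> (act X \<rho> x)"
    and ex_finite_support: "\<exists>S. finite S \<and> supports X S x"
  using assms unfolding nominal_set_def by blast+

lemma act_inverse:
  assumes "nominal_set X" and "x \<in> car X"
  shows "act X (inverse \<pi>) (act X \<pi> x) = x" "act X \<pi> (act X (inverse \<pi>) x) = x"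
  using assms by (simp_all add: act_one flip: act_times)

text \<open>Changing the fresh name of an abstraction and transporting the rule \<open>perm\<close>
  along a permutation both reduce to this law.\<close>

lemma act_swap:
  assumes "nominal_set X" and "x \<in> car X"
  shows "act X \<pi> (act X \<langle>a \<leftrightarrow> b\<rangle> x) = act X \<langle>\<pi> \<langle>$\<rangle> a \<leftrightarrow> \<pi> \<langle>$\<rangle> b\<rangle> (act X \<pi> x)"
  using assms by (simp add: perm_swap_left_commute flip: act_times)

lemma supports_swap:
  "supports X S x \<Longrightarrow> a \<notin> S \<Longrightarrow> b \<notin> S \<Longrightarrow> act X \<langle>a \<leftrightarrow> b\<rangle> x = x"
  unfolding supports_def by (metis apply_swap_same)

text \<open>A finite permutation is a product of transpositions of names that it moves, and names
  moved by a permutation fixing \<open>S\<close> lie outside \<open>S\<close>. The induction on the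
  number of moved names splits off one such transposition at a time.\<close>

lemma supportsI_swap:
  assumes X: "nominal_set X" "x \<in> car X"
    and swap: "\<And>a b. a \<notin> S \<Longrightarrow> b \<notin> S \<Longrightarrow> act X \<langle>a \<leftrightarrow> b\<rangle> x = x"
  shows "supports X S x"
  unfolding supports_def
proof (intro allI impI)
  fix \<pi>
  assume "\<forall>a\<in>S. \<pi> \<langle>$\<rangle> a = a"
  then show "act X \<pi> x = x"
  proof (induction "card (affected \<pi>)" arbitrary: \<pi> rule: less_induct)
    case less
    show ?case
    proof (cases "\<pi> = 1")
      case True
      then show ?thesis
        using X by (simp add: act_one)
    next
      case False
      then obtain a where a: "\<pi> \<langle>$\<rangle> a \<noteq> a"
        by (metis affected_empty_iff equals0I in_affected)
      define b where "b = \<pi> \<langle>$\<rangle> a"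
      \<comment> \<open>Cancelling the step from \<open>a\<close> to \<open>b\<close> makes
        \<open>a\<close> a fixed name while all names fixed by \<open>\<pi>\<close> stay fixed, so
        fewer names are affected.\<close>
      define \<rho> where "\<rho> = \<langle>a \<leftrightarrow> b\<rangle> * \<pi>"
      have "\<pi> \<langle>$\<rangle> b \<noteq> b"
        using a unfolding b_def by (simp add: apply_inj)
      then have ab: "a \<notin> S" "b \<notin> S"
        using a less.prems by (auto simp: b_def)
      have \<rho>_fix: "\<rho> \<langle>$\<rangle> c = c" if "\<pi> \<langle>$\<rangle> c = c" for c
        using that a \<open>\<pi> \<langle>$\<rangle> b \<noteq> b\<close> by (metis \<rho>_def apply_sequence apply_swap_same)
      have "\<rho> \<langle>$\<rangle> a = a"
        by (simp add: \<rho>_def apply_times b_def)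
      then have "affected \<rho> \<subset> affected \<pi>"
        using \<rho>_fix a by (auto simp: in_affected)
      then have "card (affected \<rho>) < card (affected \<pi>)"
        by (simp add: psubset_card_mono)
      then have "act X \<rho> x = x"
        using less \<rho>_fix by auto
      moreover have "\<pi> = \<langle>a \<leftrightarrow> b\<rangle> * \<rho>"
        by (simp add: \<rho>_def flip: mult.assoc)
      ultimately show ?thesis
        using X swap[OF ab] by (simp add: act_times)
    qed
  qed
qed

text \<open>A name \<open>c\<close> outside both supports mediates: each of \<open>a\<close> and
  \<open>b\<close> is missed by one of them, so \<open>x\<close> is fixed by (a c) and (b c), and
  conjugating the second by the first gives (b a). Such a \<open>c\<close> exists because there are
  infinitely many names.\<close>

lemma supports_Int:
  fixes X :: "('a::infinite, 'x) nomset"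
  assumes X: "nominal_set X" "x \<in> car X"
    and S: "finite S" "supports X S x" and S': "finite S'" "supports X S' x"
  shows "supports X (S \<inter> S') x"
proof (rule supportsI_swap[OF X])
  fix a b
  assume a: "a \<notin> S \<inter> S'" and b: "b \<notin> S \<inter> S'"
  obtain c where c: "c \<notin> S \<union> S' \<union> {a, b}"
    using arb_element[of "S \<union> S' \<union> {a, b}"] S S' by auto
  have ac: "act X \<langle>a \<leftrightarrow> c\<rangle> x = x" and bc: "act X \<langle>b \<leftrightarrow> c\<rangle> x = x"
    using a b c S S' by (metis IntI UnCI supports_swap)+
  show "act X \<langle>a \<leftrightarrow> b\<rangle> x = x"
  proof (cases "a = b")
    case True
    then show ?thesis
      using X by (simp add: act_one)
  next
    case False
    then have "\<langle>a \<leftrightarrow> c\<rangle> \<langle>$\<rangle> b = b"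
      using c by auto
    then have "act X \<langle>a \<leftrightarrow> c\<rangle> (act X \<langle>b \<leftrightarrow> c\<rangle> x) = act X \<langle>b \<leftrightarrow> a\<rangle> (act X \<langle>a \<leftrightarrow> c\<rangle> x)"
      using act_swap[OF X, of "\<langle>a \<leftrightarrow> c\<rangle>" b c] by simp
    then show ?thesis
      unfolding ac bc by (simp add: swap_sym[of a b])
  qed
qed

text \<open>A finite support of minimal cardinality lies inside every finite support, because
  intersecting it with another one cannot make it smaller. This gives the \<open>LEAST\<close> in
  the definition of \<open>supp\<close> its value.\<close>

lemma supp_least:
  fixes X :: "('a::infinite, 'x) nomset"
  assumes X: "nominal_set X" "x \<in> car X"
  shows finite_supp: "finite (supp X x)"
    and supports_supp: "supports X (supp X x) x"
    and supp_subset: "finite S \<Longrightarrow> supports X S x \<Longrightarrow> supp X x \<subseteq> S"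
proof -
  let ?P = "\<lambda>S. finite S \<and> supports X S x"
  obtain S0 where S0: "?P S0" "\<And>S. ?P S \<Longrightarrow> card S0 \<le> card S"
    using ex_finite_support[OF X] ex_has_least_nat[of ?P _ card] by blast
  have least: "S0 \<subseteq> S" if "?P S" for S
  proof -
    have "?P (S0 \<inter> S)"
      using supports_Int[OF X] S0(1) that by blast
    then have "card S0 \<le> card (S0 \<inter> S)"
      by (rule S0(2))
    then have "S0 \<inter> S = S0"
      using S0(1) by (meson card_seteq inf_le1)
    then show ?thesis
      by blast
  qed
  have "supp X x = S0"
    unfolding supp_def using S0(1) least by (rule Least_equality)
  then show "finite (supp X x)" "supports X (supp X x) x"
      "finite S \<Longrightarrow> supports X S x \<Longrightarrow> supp X x \<subseteq> S"
    using S0(1) least by auto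
qed

lemma freshI:
  fixes X :: "('a::infinite, 'x) nomset"
  assumes "nominal_set X" "x \<in> car X" "finite S" "supports X S x" "a \<notin> S"
  shows "fresh X a x"
  using supp_subset[OF assms(1-4)] assms(5) unfolding fresh_def by blast

lemma fresh_swap:
  fixes X :: "('a::infinite, 'x) nomset"
  assumes "nominal_set X" "x \<in> car X" "fresh X a x" "fresh X b x"
  shows "act X \<langle>a \<leftrightarrow> b\<rangle> x = x"
  using assms(3,4) supports_swap[OF supports_supp[OF assms(1,2)]] by (simp add: fresh_def)

lemma obtain_fresh:
  fixes X :: "('a::infinite, 'x) nomset"
  assumes "nominal_set X" "finite N" "finite M" "M \<subseteq> car X"
  obtains c where "c \<notin> N" "\<And>x. x \<in> M \<Longrightarrow> fresh X c x"
proof -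
  have "finite (N \<union> (\<Union>x\<in>M. supp X x))"
    using assms finite_supp by (metis finite_UN finite_UnI subsetD)
  then obtain c where "c \<notin> N \<union> (\<Union>x\<in>M. supp X x)"
    using arb_element by blast
  then show thesis
    using that unfolding fresh_def by blast
qed

lemma supports_equivariant_image:
  assumes "equivariant X Y f" "x \<in> car X" "supports X S x"
  shows "supports Y S (f x)"
  using assms unfolding equivariant_def supports_def by metis

lemma fresh_equivariant_image:
  fixes X :: "('a::infinite, 'x) nomset"
  assumes "nominal_set X" "nominal_set Y" "equivariant X Y f" "x \<in> car X" "fresh X a x"
  shows "fresh Y a (f x)"
proof (rule freshI)
  show "supports Y (supp X x) (f x)"
    by (rule supports_equivariant_image[OF assms(3,4) supports_supp[OF assms(1,4)]])
qed (use assms in \<open>auto simp: equivariant_def fresh_def finite_supp\<close>)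

lemma supports_act:
  assumes X: "nominal_set X" "x \<in> car X" and S: "supports X S x"
  shows "supports X (Perm.apply \<pi> ` S) (act X \<pi> x)"
  unfolding supports_def
proof (intro allI impI)
  fix \<rho>
  assume \<rho>: "\<forall>a\<in>Perm.apply \<pi> ` S. \<rho> \<langle>$\<rangle> a = a"
  \<comment> \<open>The conjugate of \<open>\<rho>\<close> fixes \<open>S\<close> pointwise because
    \<open>\<rho>\<close> fixes the image of \<open>S\<close> under \<open>\<pi>\<close>.\<close>
  have "act X (inverse \<pi> * (\<rho> * \<pi>)) x = x"
    using S \<rho> unfolding supports_def by (simp add: apply_times)
  then have "act X \<pi> (act X (inverse \<pi> * (\<rho> * \<pi>)) x) = act X \<pi> x"
    by simp
  then show "act X \<rho> (act X \<pi> x) = act X \<pi> x"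
    using X by (simp flip: act_times mult.assoc)
qed

lemma fresh_act:
  fixes X :: "('a::infinite, 'x) nomset"
  assumes "nominal_set X" "x \<in> car X" "fresh X a x"
  shows "fresh X (\<pi> \<langle>$\<rangle> a) (act X \<pi> x)"
proof (rule freshI)
  show "supports X (Perm.apply \<pi> ` supp X x) (act X \<pi> x)"
    using assms by (simp add: supports_act supports_supp)
qed (use assms in \<open>auto simp: act_in_car finite_supp fresh_def apply_inj\<close>)

section \<open>Names and tuples as nominal sets\<close>

lemma nominal_set_names: "nominal_set names"
proof -
  have "supports names {a} a" for a
    by (simp add: supports_def names_def)
  then show ?thesis
    unfolding nominal_set_def names_def by (auto simp: apply_times intro!: exI[of _ "{_}"])
qed

lemma fresh_names_iff:
  fixes a b :: "'a::infinite"
  shows "fresh names a b \<longleftrightarrow> a \<noteq> b"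
proof
  assume "a \<noteq> b"
  then show "fresh names a b"
    by (intro freshI[where S = "{b}"])
      (auto simp: nominal_set_names, auto simp: names_def supports_def)
next
  assume *: "fresh names a b"
  show "a \<noteq> b"
  proof
    assume "a = b"
    \<comment> \<open>If \<open>b\<close> were fresh for itself, swapping it with another fresh name
      \<open>c\<close> would fix \<open>b\<close>, yet the swap sends \<open>b\<close> to
      \<open>c\<close>.\<close>
    obtain c where "c \<notin> {b}" "fresh names c b"
      using obtain_fresh[OF nominal_set_names, of "{b}" "{b}"] by (auto simp: names_def)
    then show False
      using fresh_swap[OF nominal_set_names, of b a c] * \<open>a = b\<close> by (simp add: names_def)
  qed
qed

lemma nominal_set_pow:
  fixes X :: "('a, 'x) nomset"
  assumes X: "nominal_set X"
  shows "nominal_set (pow_nom p X)"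
proof -
  have "\<exists>S. finite S \<and> supports (pow_nom p X) S xs" if xs: "set xs \<subseteq> car X" for xs
  proof -
    have "\<forall>x\<in>set xs. \<exists>S. finite S \<and> supports X S x"
      using X xs ex_finite_support by (metis subsetD)
    then obtain F where F: "\<And>x. x \<in> set xs \<Longrightarrow> finite (F x) \<and> supports X (F x) x"
      by metis
    have "supports (pow_nom p X) (\<Union>x\<in>set xs. F x) xs"
      using F unfolding supports_def pow_nom_def by (auto intro!: map_idI)
    then show ?thesis
      using F by blast
  qed
  then show ?thesis
    using X unfolding nominal_set_def pow_nom_def
    by (auto simp: subset_iff intro!: map_idI)
qed

lemma pow_nom_simps [simp]:
  "xs \<in> car (pow_nom p X) \<longleftrightarrow> length xs = p \<and> set xs \<subseteq> car X"
  "act (pow_nom p X) \<pi> = map (act X \<pi>)"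
  by (auto simp: pow_nom_def)

lemma fresh_pow:
  fixes X :: "('a::infinite, 'x) nomset"
  assumes "nominal_set X" "xs \<in> car (pow_nom p X)" "\<And>x. x \<in> set xs \<Longrightarrow> fresh X a x"
  shows "fresh (pow_nom p X) a xs"
proof (rule freshI[OF nominal_set_pow])
  have "supports X (supp X x) x" if "x \<in> set xs" for x
    using assms that by (auto intro: supports_supp)
  then show "supports (pow_nom p X) (\<Union>x\<in>set xs. supp X x) xs"
    unfolding supports_def by (auto intro!: map_idI)
qed (use assms in \<open>auto simp: fresh_def intro: finite_supp\<close>)

section \<open>Name abstraction\<close>

lemma abs_rel_iff:
  fixes X :: "('a::infinite, 'x) nomset"
  shows "((a, x), (b, y)) \<in> abs_rel X \<longleftrightarrow> x \<in> car X \<and> y \<in> car X \<and>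
    (\<exists>c. c \<noteq> a \<and> c \<noteq> b \<and> fresh X c x \<and> fresh X c y \<and>
      act X \<langle>c \<leftrightarrow> a\<rangle> x = act X \<langle>c \<leftrightarrow> b\<rangle> y)"
  by (auto simp: abs_rel_def fresh_names_iff)

text \<open>By conjugation (d c)(c a) equals (d a)(d c), and (d c) fixes \<open>x\<close> since both
  of its names are fresh for \<open>x\<close>.\<close>

lemma swap_fresh_swap:
  fixes X :: "('a::infinite, 'x) nomset"
  assumes "nominal_set X" "x \<in> car X" "fresh X c x" "fresh X d x" "c \<noteq> a" "d \<noteq> a"
  shows "act X \<langle>d \<leftrightarrow> c\<rangle> (act X \<langle>c \<leftrightarrow> a\<rangle> x) = act X \<langle>d \<leftrightarrow> a\<rangle> x"
  using assms act_swap[of X x "\<langle>d \<leftrightarrow> c\<rangle>" c a] by (simp add: fresh_swap)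

text \<open>The existential in \<open>abs_rel\<close> may be read universally: applying (d c) to the
  equation at the given witness \<open>c\<close> turns it into the equation at \<open>d\<close>.
  Hence the witness may be chosen as fresh as an argument demands.\<close>

lemma abs_rel_any:
  fixes X :: "('a::infinite, 'x) nomset"
  assumes X: "nominal_set X" and rel: "((a, x), (b, y)) \<in> abs_rel X"
    and d: "d \<noteq> a" "d \<noteq> b" "fresh X d x" "fresh X d y"
  shows "act X \<langle>d \<leftrightarrow> a\<rangle> x = act X \<langle>d \<leftrightarrow> b\<rangle> y"
proof -
  from rel obtain c where xy: "x \<in> car X" "y \<in> car X" and c: "c \<noteq> a" "c \<noteq> b" "fresh X c x"
      "fresh X c y" and eq: "act X \<langle>c \<leftrightarrow> a\<rangle> x = act X \<langle>c \<leftrightarrow> b\<rangle> y"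
    by (auto simp: abs_rel_iff)
  have "act X \<langle>d \<leftrightarrow> a\<rangle> x = act X \<langle>d \<leftrightarrow> c\<rangle> (act X \<langle>c \<leftrightarrow> a\<rangle> x)"
    using X xy c d by (simp add: swap_fresh_swap)
  also have "\<dots> = act X \<langle>d \<leftrightarrow> b\<rangle> y"
    unfolding eq using X xy c d by (simp add: swap_fresh_swap)
  finally show ?thesis .
qed

lemma equiv_abs_rel:
  fixes X :: "('a::infinite, 'x) nomset"
  assumes X: "nominal_set X"
  shows "equiv (car (prod_nom names X)) (abs_rel X)"
proof (rule equivI)
  show "abs_rel X \<subseteq> car (prod_nom names X) \<times> car (prod_nom names X)"
    by (auto simp: abs_rel_def prod_nom_def names_def)
  show "refl_on (car (prod_nom names X)) (abs_rel X)"
  proof (rule refl_onI)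
    fix z
    assume "z \<in> car (prod_nom names X)"
    then obtain a x where z: "z = (a, x)" and x: "x \<in> car X"
      by (auto simp: prod_nom_def)
    obtain c where "c \<notin> {a}" "fresh X c x"
      using obtain_fresh[OF X, of "{a}" "{x}"] x by auto
    then show "(z, z) \<in> abs_rel X"
      using x by (auto simp: z abs_rel_iff)
  qed
  show "sym (abs_rel X)"
    unfolding sym_def by (fastforce simp: abs_rel_iff)
  show "trans (abs_rel X)"
  proof (rule transI, clarify)
    fix a x b y c z
    assume 1: "((a, x), (b, y)) \<in> abs_rel X" and 2: "((b, y), (c, z)) \<in> abs_rel X"
    then have car: "x \<in> car X" "y \<in> car X" "z \<in> car X"
      by (auto simp: abs_rel_iff)
    \<comment> \<open>One name fresh for all three pairs witnesses both given equalities, which can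
      then be composed.\<close>
    obtain d where d: "d \<notin> {a, b, c}" "\<And>v. v \<in> {x, y, z} \<Longrightarrow> fresh X d v"
      using obtain_fresh[OF X, of "{a, b, c}" "{x, y, z}"] car by auto
    then have "act X \<langle>d \<leftrightarrow> a\<rangle> x = act X \<langle>d \<leftrightarrow> c\<rangle> z"
      using abs_rel_any[OF X 1, of d] abs_rel_any[OF X 2, of d] by simp
    then show "((a, x), (c, z)) \<in> abs_rel X"
      using car d by (auto simp: abs_rel_iff)
  qed
qed

lemma abs_class_eq_iff:
  fixes X :: "('a::infinite, 'x) nomset"
  assumes "nominal_set X" "x \<in> car X" "y \<in> car X"
  shows "abs_class X a x = abs_class X b y \<longleftrightarrow> ((a, x), (b, y)) \<in> abs_rel X"
  unfolding abs_class_def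
  by (rule eq_equiv_class_iff[OF equiv_abs_rel]) (use assms in \<open>auto simp: prod_nom_def names_def\<close>)

text \<open>Renaming of a bound name to a fresh one, the semantic counterpart of the rule
  \<open>perm\<close>. A further fresh name \<open>c\<close> is a witness because (c a)(a b) acts on
  \<open>x\<close> as (c b).\<close>

lemma abs_class_swap:
  fixes X :: "('a::infinite, 'x) nomset"
  assumes X: "nominal_set X" "x \<in> car X" and a: "fresh X a x" "a \<noteq> b"
  shows "abs_class X a (act X \<langle>a \<leftrightarrow> b\<rangle> x) = abs_class X b x"
proof -
  let ?y = "act X \<langle>a \<leftrightarrow> b\<rangle> x"
  have y: "?y \<in> car X"
    using X by (rule act_in_car)
  obtain c where c: "c \<notin> {a, b}" "\<And>v. v \<in> {x, ?y} \<Longrightarrow> fresh X c v"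
    using obtain_fresh[OF X(1), of "{a, b}" "{x, ?y}"] X y by auto
  then have "act X \<langle>c \<leftrightarrow> a\<rangle> ?y = act X \<langle>c \<leftrightarrow> b\<rangle> x"
    using X a by (simp add: swap_fresh_swap)
  then have "((a, ?y), (b, x)) \<in> abs_rel X"
    using c X y by (auto simp: abs_rel_iff)
  then show ?thesis
    using X y by (simp add: abs_class_eq_iff)
qed

lemma abs_rel_act:
  fixes X :: "('a::infinite, 'x) nomset"
  assumes X: "nominal_set X" and rel: "((a, x), (b, y)) \<in> abs_rel X"
  shows "((\<pi> \<langle>$\<rangle> a, act X \<pi> x), (\<pi> \<langle>$\<rangle> b, act X \<pi> y)) \<in> abs_rel X"
proof -
  from rel obtain c where xy: "x \<in> car X" "y \<in> car X" and c: "c \<noteq> a" "c \<noteq> b" "fresh X c x"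
      "fresh X c y" and eq: "act X \<langle>c \<leftrightarrow> a\<rangle> x = act X \<langle>c \<leftrightarrow> b\<rangle> y"
    by (auto simp: abs_rel_iff)
  from eq have "act X \<pi> (act X \<langle>c \<leftrightarrow> a\<rangle> x) = act X \<pi> (act X \<langle>c \<leftrightarrow> b\<rangle> y)"
    by simp
  then have "act X \<langle>\<pi> \<langle>$\<rangle> c \<leftrightarrow> \<pi> \<langle>$\<rangle> a\<rangle> (act X \<pi> x) = act X \<langle>\<pi> \<langle>$\<rangle> c \<leftrightarrow> \<pi> \<langle>$\<rangle> b\<rangle> (act X \<pi> y)"
    using X xy by (simp add: act_swap)
  then show ?thesis
    using X xy c by (auto simp: abs_rel_iff act_in_car fresh_act apply_inj
        intro!: exI[of _ "\<pi> \<langle>$\<rangle> c"])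
qed

text \<open>Equivariance of the relation gives one inclusion for the elementwise image, and the same
  inclusion for \<open>inverse \<pi>\<close> gives the other.\<close>

lemma act_abs_class:
  fixes X :: "('a::infinite, 'x) nomset"
  assumes X: "nominal_set X" "x \<in> car X"
  shows "act (abs_nom X) \<pi> (abs_class X a x) = abs_class X (\<pi> \<langle>$\<rangle> a) (act X \<pi> x)"
proof -
  let ?f = "\<lambda>\<pi>. map_prod (Perm.apply \<pi>) (act X \<pi>)"
  have sub: "?f \<pi> ` abs_class X a x \<subseteq> abs_class X (\<pi> \<langle>$\<rangle> a) (act X \<pi> x)" for \<pi> a x
    using abs_rel_act[OF X(1)] by (auto simp: abs_class_def)
  have "abs_class X (\<pi> \<langle>$\<rangle> a) (act X \<pi> x) \<subseteq> ?f \<pi> ` abs_class X a x"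
  proof
    fix z
    assume z: "z \<in> abs_class X (\<pi> \<langle>$\<rangle> a) (act X \<pi> x)"
    then have "?f (inverse \<pi>) z \<in> abs_class X a x"
      using sub[of "inverse \<pi>" "\<pi> \<langle>$\<rangle> a" "act X \<pi> x"] X by (auto simp: act_inverse)
    moreover have "?f \<pi> (?f (inverse \<pi>) z) = z"
      using z X by (cases z) (auto simp: abs_class_def abs_rel_def act_inverse)
    ultimately show "z \<in> ?f \<pi> ` abs_class X a x"
      by (metis image_eqI)
  qed
  then have "?f \<pi> ` abs_class X a x = abs_class X (\<pi> \<langle>$\<rangle> a) (act X \<pi> x)"
    using sub by (intro equalityI)
  then show ?thesis
    by (simp add: abs_nom_def prod_nom_def names_def)
qed

lemma car_abs_nom: "car (abs_nom X) = {abs_class X a x | a x. x \<in> car X}"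
  by (auto simp: abs_nom_def abs_class_def quotient_def prod_nom_def names_def)

section \<open>Terms\<close>

lemma act_Term [simp]: "act (Term \<Sigma> m X) = trm_act X"
  by (simp add: Term_def)

lemma Var_in_Term [simp]: "Var x \<in> car (Term \<Sigma> m X) \<longleftrightarrow> x \<in> car X \<and> m = 0"
  by (auto simp: Term_def intro: terms.intros uniform_depth.intros
      elim: terms.cases uniform_depth.cases)

lemma App_in_Term:
  "App \<eta> f ts \<in> car (Term \<Sigma> k X) \<longleftrightarrow>
    (\<exists>m. k = m + depth \<Sigma> f \<and> op_pfx \<Sigma> \<eta> f \<and> length ts = arity \<Sigma> f \<and>
      set ts \<subseteq> car (Term \<Sigma> m X))"
proof
  assume "App \<eta> f ts \<in> car (Term \<Sigma> k X)"
  then have "App \<eta> f ts \<in> terms \<Sigma> (car X)" "uniform_depth \<Sigma> k (App \<eta> f ts)"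
    by (simp_all add: Term_def)
  then show "\<exists>m. k = m + depth \<Sigma> f \<and> op_pfx \<Sigma> \<eta> f \<and> length ts = arity \<Sigma> f \<and>
      set ts \<subseteq> car (Term \<Sigma> m X)"
    by (auto elim!: terms.cases uniform_depth.cases simp: Term_def)
qed (auto simp: Term_def intro!: terms.intros uniform_depth.intros)

lemma App_in_TermI:
  "op_pfx \<Sigma> \<eta> f \<Longrightarrow> length ts = arity \<Sigma> f \<Longrightarrow> set ts \<subseteq> car (Term \<Sigma> m X) \<Longrightarrow>
    App \<eta> f ts \<in> car (Term \<Sigma> (m + depth \<Sigma> f) X)"
  by (auto simp: App_in_Term)

text \<open>A constant has many uniform depths, so the depth of the arguments is not determined by
  the term alone. The induction therefore runs over raw terms with the depth generalised and reads
  the arguments' depth off the depth of the whole.\<close>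

lemma Term_induct [consumes 1, case_names Var App]:
  assumes "t \<in> car (Term \<Sigma> m X)"
    and "\<And>x. x \<in> car X \<Longrightarrow> P 0 (Var x)"
    and "\<And>\<eta> f ts m. op_pfx \<Sigma> \<eta> f \<Longrightarrow> length ts = arity \<Sigma> f \<Longrightarrow> set ts \<subseteq> car (Term \<Sigma> m X) \<Longrightarrow>
      (\<And>t. t \<in> set ts \<Longrightarrow> P m t) \<Longrightarrow> P (m + depth \<Sigma> f) (App \<eta> f ts)"
  shows "P m t"
  using assms(1)
proof (induction t arbitrary: m)
  case (Var x)
  then show ?case
    using assms(2) by simp
next
  case (App \<eta> f ts)
  then obtain k where "m = k + depth \<Sigma> f" "op_pfx \<Sigma> \<eta> f" "length ts = arity \<Sigma> f"
      "set ts \<subseteq> car (Term \<Sigma> k X)"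
    by (auto simp: App_in_Term)
  then show ?case
    using App.IH assms(3) by (simp add: subset_iff)
qed

lemma op_pfx_act [simp]: "op_pfx \<Sigma> (pfx_act \<pi> \<eta>) f \<longleftrightarrow> op_pfx \<Sigma> \<eta> f"
  by (cases \<eta>) simp_all

lemma trm_act_in_Term:
  assumes "nominal_set X" "t \<in> car (Term \<Sigma> m X)"
  shows "trm_act X \<pi> t \<in> car (Term \<Sigma> m X)"
  using assms(2) by (induction rule: Term_induct)
    (auto simp: act_in_car[OF assms(1)] intro!: App_in_TermI)

lemma nominal_set_Term:
  fixes X :: "('a, 'x) nomset" and \<Sigma> :: "'f signature"
  assumes X: "nominal_set X"
  shows "nominal_set (Term \<Sigma> m X)"
proof -
  have "trm_act X 1 t = t" if "t \<in> car (Term \<Sigma> m X)" for t :: "('a, 'f, 'x) trm"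
    using that
  proof (induction rule: Term_induct)
    case (App \<eta> f ts)
    then show ?case
      by (cases \<eta>) (auto intro: map_idI)
  qed (simp add: act_one[OF X])
  moreover have "trm_act X (\<pi> * \<rho>) t = trm_act X \<pi> (trm_act X \<rho> t)"
    if "t \<in> car (Term \<Sigma> m X)" for \<pi> \<rho> and t :: "('a, 'f, 'x) trm"
    using that
  proof (induction rule: Term_induct)
    case (App \<eta> f ts)
    then show ?case
      by (cases \<eta>) (auto simp: apply_times)
  qed (simp add: act_times[OF X])
  moreover have "\<exists>S. finite S \<and> (\<forall>\<pi>. (\<forall>a\<in>S. \<pi> \<langle>$\<rangle> a = a) \<longrightarrow> trm_act X \<pi> t = t)"
    if "t \<in> car (Term \<Sigma> m X)" for t :: "('a, 'f, 'x) trm"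
    using that
  proof (induction rule: Term_induct)
    case (Var x)
    then show ?case
      using ex_finite_support[OF X] by (auto simp: supports_def)
  next
    case (App \<eta> f ts)
    then obtain F where F: "\<And>t. t \<in> set ts \<Longrightarrow> finite (F t)"
        "\<And>t \<pi>. t \<in> set ts \<Longrightarrow> \<forall>a\<in>F t. \<pi> \<langle>$\<rangle> a = a \<Longrightarrow> trm_act X \<pi> t = t"
      by metis
    \<comment> \<open>The name of the prefix is included even when it is bound: raw terms are not
      identified up to renaming, and a permutation acts on binders literally.\<close>
    show ?case
      using F by (intro exI[of _ "set_pfx \<eta> \<union> (\<Union>t\<in>set ts. F t)"], cases \<eta>)
        (auto intro!: map_idI)
  qed
  ultimately show ?thesis
    unfolding nominal_set_def supports_def by (simp add: trm_act_in_Term[OF X])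
qed

lemma subst_in_Term:
  assumes "\<And>y. y \<in> car Y \<Longrightarrow> \<sigma> y \<in> car (Term \<Sigma> l X)" "t \<in> car (Term \<Sigma> m Y)"
  shows "subst \<sigma> t \<in> car (Term \<Sigma> (m + l) X)"
  using assms(2)
proof (induction rule: Term_induct)
  case (App \<eta> f ts m)
  then have "App \<eta> f (map (subst \<sigma>) ts) \<in> car (Term \<Sigma> (m + l + depth \<Sigma> f) X)"
    by (intro App_in_TermI) auto
  then show ?case
    by (simp add: ac_simps)
qed (simp add: assms(1))

text \<open>Substitution leaves binders untouched, so the permutation passes through node by node;
  at a variable the inverse in the conjugated substitution cancels against the permutation already
  applied there.\<close>

lemma trm_act_subst:
  assumes "nominal_set Y" "t \<in> car (Term \<Sigma> m Y)"
  shows "trm_act X \<pi> (subst \<sigma> t) =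
    subst (\<lambda>y. trm_act X \<pi> (\<sigma> (act Y (inverse \<pi>) y))) (trm_act Y \<pi> t)"
  using assms(2)
proof (induction rule: Term_induct)
  case (App \<eta> f ts)
  then show ?case
    by (cases \<eta>) auto
qed (simp add: act_inverse[OF assms(1)])

section \<open>Derivable equality\<close>

locale nominal_theory =
  fixes T :: "('a::infinite, 'f, 'y) graded_theory" and X :: "('a, 'x) nomset"
  assumes graded: "is_graded_theory T" and nominal: "nominal_set X"
begin

abbreviation "Trm m \<equiv> Term (Sig T) m X"

lemmas nominal_Trm = nominal_set_Term[OF nominal, of "Sig T"]

lemmas trm_act_Trm = trm_act_in_Term[OF nominal, of _ "Sig T"]

lemma trm_act_times:
  "t \<in> car (Trm m) \<Longrightarrow> trm_act X (\<pi> * \<rho>) t = trm_act X \<pi> (trm_act X \<rho> t)"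
  using act_times[OF nominal_Trm] by simp

lemma axiomD:
  assumes "e \<in> Axs T"
  shows "nominal_set (eq_ctx e)"
    and "eq_lhs e \<in> car (Term (Sig T) (eq_depth e) (eq_ctx e))"
    and "eq_rhs e \<in> car (Term (Sig T) (eq_depth e) (eq_ctx e))"
  using assms graded by (auto simp: is_graded_theory_def is_equation_def)

lemma derivable_in_Term:
  assumes "derivable T X m t u"
  shows "t \<in> car (Trm m) \<and> u \<in> car (Trm m)"
  using assms
proof (induction rule: derivable.induct)
  case (cong \<eta> f ts m us)
  then show ?case
    by (auto intro!: App_in_TermI simp: list_all2_conv_all_nth in_set_conv_nth)
next
  case (ax e \<sigma> l \<tau>)
  then show ?case
    using axiomD[OF ax(1)] by (auto intro!: subst_in_Term trm_act_in_Term)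
next
  case (perm h ts a b us m)
  then show ?case
    by (auto intro!: App_in_TermI simp: list_all2_conv_all_nth in_set_conv_nth)
qed auto

text \<open>The rule \<open>refl\<close> speaks of variables only; congruence carries it up the
  term.\<close>

lemma derivable_refl: "t \<in> car (Trm m) \<Longrightarrow> derivable T X m t t"
proof (induction rule: Term_induct)
  case (App \<eta> f ts m)
  then show ?case
    by (intro derivable.cong) (auto intro: list.rel_refl_strong)
qed (rule derivable.refl)

text \<open>Equivariance is not a rule of the calculus but is admissible. The case of
  \<open>ax\<close> conjugates the substitution and absorbs the permutation into the
  \<open>\<tau>\<close> of the rule; the case of \<open>perm\<close> permutes the two names along
  with the terms.\<close>

lemma derivable_act: "derivable T X m t u \<Longrightarrow> derivable T X m (trm_act X \<pi> t) (trm_act X \<pi> u)"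
proof (induction rule: derivable.induct)
  case (refl x)
  then show ?case
    by (simp add: derivable.refl act_in_car[OF nominal])
next
  case (symm m t u)
  then show ?case
    by (blast intro: derivable.symm)
next
  case (trans m t u v)
  then show ?case
    by (blast intro: derivable.trans)
next
  case (cong \<eta> f ts m us)
  then show ?case
    by (auto intro!: derivable.cong simp: list_all2_conv_all_nth)
next
  case (ax e \<sigma> l \<tau>)
  let ?Y = "eq_ctx e"
  let ?\<sigma> = "\<lambda>y. trm_act X \<pi> (\<sigma> (act ?Y (inverse \<pi>) y))"
  note e = axiomD[OF ax(1)]
  have \<sigma>: "\<sigma> y \<in> car (Trm l)" if "y \<in> car ?Y" for y
    using ax(2) that by blast
  \<comment> \<open>The side condition for the conjugated substitution at \<open>\<rho>\<close> is
    the image under \<open>\<pi>\<close> of the one for \<open>\<sigma>\<close> at the conjugate of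
    \<open>\<rho>\<close>.\<close>
  have "derivable T X l (trm_act X \<rho> (?\<sigma> y)) (?\<sigma> (act ?Y \<rho> y))" if y: "y \<in> car ?Y" for \<rho> y
  proof -
    let ?y = "act ?Y (inverse \<pi>) y" and ?\<rho> = "inverse \<pi> * (\<rho> * \<pi>)"
    have y': "?y \<in> car ?Y"
      using e(1) y by (rule act_in_car)
    have "trm_act X \<pi> (trm_act X ?\<rho> (\<sigma> ?y)) = trm_act X \<rho> (?\<sigma> y)"
      using \<sigma>[OF y'] by (simp flip: trm_act_times mult.assoc)
    moreover have "act ?Y ?\<rho> ?y = act ?Y (inverse \<pi>) (act ?Y \<rho> y)"
      using y e(1) by (simp add: mult.assoc flip: act_times)
    moreover have "derivable T X l (trm_act X \<pi> (trm_act X ?\<rho> (\<sigma> ?y)))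
        (trm_act X \<pi> (\<sigma> (act ?Y ?\<rho> ?y)))"
      using ax(3) y' by blast
    ultimately show ?thesis
      by simp
  qed
  moreover have "?\<sigma> y \<in> car (Trm l)" if "y \<in> car ?Y" for y
    using that e(1) by (intro trm_act_Trm \<sigma> act_in_car)
  ultimately have "derivable T X (eq_depth e + l)
      (subst ?\<sigma> (trm_act ?Y (\<pi> * \<tau>) (eq_lhs e))) (subst ?\<sigma> (trm_act ?Y (\<pi> * \<tau>) (eq_rhs e)))"
    using ax(1) by (intro derivable.ax) auto
  moreover have "subst ?\<sigma> (trm_act ?Y (\<pi> * \<tau>) t) = trm_act X \<pi> (subst \<sigma> (trm_act ?Y \<tau> t))"
    if "t \<in> car (Term (Sig T) (eq_depth e) ?Y)" for t
    using trm_act_subst[OF e(1) trm_act_in_Term[OF e(1) that], of X \<pi> \<sigma> \<tau>]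
      act_times[OF nominal_set_Term[OF e(1)] that] by simp
  ultimately show ?case
    using e by simp
next
  case (perm h ts a b us m)
  have "derivable T X (m + depth (Sig T) h) (App (Nu (\<pi> \<langle>$\<rangle> a)) h (map (trm_act X \<pi>) ts))
      (App (Nu (\<pi> \<langle>$\<rangle> b)) h (map (trm_act X \<pi>) us))"
  proof (rule derivable.perm)
    show "\<forall>u\<in>set (map (trm_act X \<pi>) us).
        u \<in> car (Trm m) \<and> fresh (Trm m) (\<pi> \<langle>$\<rangle> a) u"
      using perm(4) fresh_act[OF nominal_Trm] by (auto simp: trm_act_Trm)
    have "trm_act X \<pi> (trm_act X \<langle>a \<leftrightarrow> b\<rangle> u) =
        trm_act X \<langle>\<pi> \<langle>$\<rangle> a \<leftrightarrow> \<pi> \<langle>$\<rangle> b\<rangle> (trm_act X \<pi> u)" if "u \<in> set us" for u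
      using act_swap[OF nominal_Trm[of m], of u \<pi> a b] perm(4) that by simp
    then show "list_all2 (\<lambda>t u. derivable T X m t (trm_act X \<langle>\<pi> \<langle>$\<rangle> a \<leftrightarrow> \<pi> \<langle>$\<rangle> b\<rangle> u))
        (map (trm_act X \<pi>) ts) (map (trm_act X \<pi>) us)"
      using perm(5) by (auto simp: list_all2_conv_all_nth)
  qed (use perm in \<open>auto simp: apply_inj\<close>)
  then show ?case
    by simp
qed

lemma equiv_der_rel: "equiv (car (Trm i)) (der_rel T X i)"
proof (rule equivI)
  show "der_rel T X i \<subseteq> car (Trm i) \<times> car (Trm i)"
    using derivable_in_Term by (auto simp: der_rel_def)
  show "refl_on (car (Trm i)) (der_rel T X i)"
    by (auto simp: der_rel_def intro: refl_onI derivable_refl)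
  show "sym (der_rel T X i)"
    by (auto simp: der_rel_def sym_def intro: derivable.symm)
  show "trans (der_rel T X i)"
    unfolding der_rel_def by (auto intro!: transI intro: derivable.trans)
qed

lemma cls_eq_iff:
  "t \<in> car (Trm i) \<Longrightarrow> u \<in> car (Trm i) \<Longrightarrow> cls T X i t = cls T X i u \<longleftrightarrow> derivable T X i t u"
  unfolding cls_def by (simp add: eq_equiv_class_iff[OF equiv_der_rel]) (simp add: der_rel_def)

text \<open>Equivariance of derivability gives one inclusion; the other pulls a member of the class
  back along \<open>inverse \<pi>\<close>.\<close>

lemma trm_act_cls:
  assumes "t \<in> car (Trm i)"
  shows "trm_act X \<pi> ` cls T X i t = cls T X i (trm_act X \<pi> t)"
proof
  show sub: "trm_act X \<pi> ` cls T X i t \<subseteq> cls T X i (trm_act X \<pi> t)"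
    using derivable_act by (auto simp: cls_def der_rel_def)
  show "cls T X i (trm_act X \<pi> t) \<subseteq> trm_act X \<pi> ` cls T X i t"
  proof
    fix u
    assume "u \<in> cls T X i (trm_act X \<pi> t)"
    then have u: "derivable T X i (trm_act X \<pi> t) u"
      by (simp add: cls_def der_rel_def)
    have "derivable T X i t (trm_act X (inverse \<pi>) u)"
      using derivable_act[OF u, of "inverse \<pi>"] act_inverse[OF nominal_Trm assms] by simp
    moreover have "u = trm_act X \<pi> (trm_act X (inverse \<pi>) u)"
      using act_inverse(2)[OF nominal_Trm[of i], of u \<pi>] derivable_in_Term[OF u] by simp
    ultimately show "u \<in> trm_act X \<pi> ` cls T X i t"
      by (auto simp: cls_def der_rel_def)
  qed
qed

section \<open>The term model\<close>

abbreviation "F \<equiv> free_model T X"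

lemma car_lev: "car (lev F i) = cls T X i ` car (Trm i)"
  by (auto simp: free_model_def Let_def cls_def quotient_def)

lemma act_lev_cls: "t \<in> car (Trm i) \<Longrightarrow> act (lev F i) \<pi> (cls T X i t) = cls T X i (trm_act X \<pi> t)"
  by (simp add: free_model_def Let_def trm_act_cls)

text \<open>As an equivariant map, the quotient map carries finite supports and freshness from terms
  over to classes.\<close>

lemma equivariant_cls: "equivariant (Trm i) (lev F i) (cls T X i)"
  by (simp add: equivariant_def car_lev act_lev_cls)

lemma nominal_set_lev: "nominal_set (lev F i)"
proof -
  have "\<exists>S. finite S \<and> supports (lev F i) S (cls T X i t)" if "t \<in> car (Trm i)" for t
    using that ex_finite_support[OF nominal_Trm that]
      supports_equivariant_image[OF equivariant_cls that] by blast
  then show ?thesis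
    using act_one[OF nominal_Trm] act_times[OF nominal_Trm]
    unfolding nominal_set_def by (auto simp: car_lev act_lev_cls trm_act_Trm)
qed

lemma equivariant_unit_map: "equivariant X (lev F 0) (unit_map T X)"
  by (simp add: equivariant_def unit_map_def car_lev act_lev_cls)

section \<open>Tuples of classes and well-definedness of the operations\<close>

lemma pow_lev_cases:
  assumes "Cs \<in> car (pow_nom p (lev F m))"
  obtains ts where "length ts = p" "set ts \<subseteq> car (Trm m)" "Cs = map (cls T X m) ts"
proof -
  have "\<forall>C\<in>set Cs. \<exists>t. t \<in> car (Trm m) \<and> C = cls T X m t"
    using assms by (auto simp: car_lev)
  then obtain r where r: "\<And>C. C \<in> set Cs \<Longrightarrow> r C \<in> car (Trm m) \<and> C = cls T X m (r C)"
    by metis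
  show thesis
    using assms r by (intro that[of "map r Cs"]) (auto intro!: map_idI[symmetric])
qed

lemma map_act_cls:
  "set ts \<subseteq> car (Trm m) \<Longrightarrow>
    map (act (lev F m) \<pi>) (map (cls T X m) ts) = map (cls T X m) (map (trm_act X \<pi>) ts)"
  by (auto simp: act_lev_cls)

lemma map_cls_eqD:
  assumes "set ts \<subseteq> car (Trm m)" "set us \<subseteq> car (Trm m)" "map (cls T X m) ts = map (cls T X m) us"
  shows "list_all2 (derivable T X m) ts us"
proof -
  have "list_all2 (\<lambda>t u. cls T X m t = cls T X m u) ts us"
    using assms(3) by (simp add: list.rel_eq[symmetric] list.rel_map)
  then show ?thesis
    using assms(1,2) by (auto simp: cls_eq_iff subset_iff elim!: list.rel_mono_strong)
qed

text \<open>The rule \<open>perm\<close> with reflexivity as its premises renames a binder to a name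
  fresh for the arguments.\<close>

lemma derivable_Nu_rename:
  assumes "h \<in> bound_ops (Sig T)" "length ts = arity (Sig T) h" "set ts \<subseteq> car (Trm m)"
    and "d \<noteq> a" "\<And>t. t \<in> set ts \<Longrightarrow> fresh (Trm m) d t"
  shows "derivable T X (m + depth (Sig T) h)
    (App (Nu d) h (map (trm_act X \<langle>d \<leftrightarrow> a\<rangle>) ts)) (App (Nu a) h ts)"
  using assms by (intro derivable.perm)
    (auto simp: list.rel_map intro!: list.rel_refl_strong derivable_refl trm_act_Trm)

text \<open>The two binders meet at a common fresh name \<open>d\<close>: the first term is renamed
  to bind \<open>d\<close>, its arguments (d a)ts are replaced by (d b)us through congruence, and
  the result is renamed back to bind \<open>b\<close>. The middle step is the equality of the
  abstractions read at the witness \<open>d\<close>.\<close>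

lemma derivable_Nu:
  assumes h: "h \<in> bound_ops (Sig T)"
    and ts: "length ts = arity (Sig T) h" "set ts \<subseteq> car (Trm m)"
    and us: "length us = arity (Sig T) h" "set us \<subseteq> car (Trm m)"
    and eq: "abs_class (pow_nom (arity (Sig T) h) (lev F m)) a (map (cls T X m) ts) =
      abs_class (pow_nom (arity (Sig T) h) (lev F m)) b (map (cls T X m) us)"
  shows "derivable T X (m + depth (Sig T) h) (App (Nu a) h ts) (App (Nu b) h us)"
proof -
  let ?P = "pow_nom (arity (Sig T) h) (lev F m)"
  note P = nominal_set_pow[OF nominal_set_lev, of "arity (Sig T) h" m]
  have car: "map (cls T X m) ts \<in> car ?P" "map (cls T X m) us \<in> car ?P"
    using ts us by (auto simp: car_lev)
  \<comment> \<open>Freshness is demanded for the representatives and not just for their classes: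
    \<open>perm\<close> needs the former, and the latter follows by equivariance of
    \<open>cls\<close>.\<close>
  obtain d where d: "d \<notin> {a, b}" and fr: "\<And>t. t \<in> set ts \<union> set us \<Longrightarrow> fresh (Trm m) d t"
    using obtain_fresh[OF nominal_Trm, of "{a, b}" "set ts \<union> set us"] ts us by auto
  have "fresh (lev F m) d (cls T X m t)" if "t \<in> set ts \<union> set us" for t
    using that fr ts us fresh_equivariant_image[OF nominal_Trm nominal_set_lev equivariant_cls]
    by blast
  then have "fresh ?P d (map (cls T X m) ts)" "fresh ?P d (map (cls T X m) us)"
    using car by (auto intro!: fresh_pow nominal_set_lev)
  moreover have "((a, map (cls T X m) ts), (b, map (cls T X m) us)) \<in> abs_rel ?P"
    using eq abs_class_eq_iff[OF P car] by simp
  ultimately have "act ?P \<langle>d \<leftrightarrow> a\<rangle> (map (cls T X m) ts) = act ?P \<langle>d \<leftrightarrow> b\<rangle> (map (cls T X m) us)"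
    using d by (intro abs_rel_any[OF P]) auto
  then have "map (cls T X m) (map (trm_act X \<langle>d \<leftrightarrow> a\<rangle>) ts) =
      map (cls T X m) (map (trm_act X \<langle>d \<leftrightarrow> b\<rangle>) us)"
    by (simp only: pow_nom_simps map_act_cls ts us)
  then have "list_all2 (derivable T X m)
      (map (trm_act X \<langle>d \<leftrightarrow> a\<rangle>) ts) (map (trm_act X \<langle>d \<leftrightarrow> b\<rangle>) us)"
    using ts us by (intro map_cls_eqD) (auto intro!: trm_act_Trm)
  then have mid: "derivable T X (m + depth (Sig T) h) (App (Nu d) h (map (trm_act X \<langle>d \<leftrightarrow> a\<rangle>) ts))
      (App (Nu d) h (map (trm_act X \<langle>d \<leftrightarrow> b\<rangle>) us))"
    using h ts by (intro derivable.cong) auto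
  show ?thesis
  proof (rule derivable.trans[OF derivable.symm derivable.trans[OF mid]])
    show "derivable T X (m + depth (Sig T) h)
        (App (Nu d) h (map (trm_act X \<langle>d \<leftrightarrow> a\<rangle>) ts)) (App (Nu a) h ts)"
      using d fr by (intro derivable_Nu_rename[OF h ts]) auto
    show "derivable T X (m + depth (Sig T) h)
        (App (Nu d) h (map (trm_act X \<langle>d \<leftrightarrow> b\<rangle>) us)) (App (Nu b) h us)"
      using d fr by (intro derivable_Nu_rename[OF h us]) auto
  qed
qed

text \<open>Each description in \<open>free_model\<close> has exactly one value here: the given
  representatives provide it, and any other ones yield a derivably equal term, by
  \<open>cong\<close> or, under a binder, by \<open>derivable_Nu\<close>.\<close>

lemma apply_op_free_model:
  assumes f: "op_pfx (Sig T) \<eta> f" and ts: "length ts = arity (Sig T) f" "set ts \<subseteq> car (Trm m)"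
  shows "apply_op (Sig T) F \<eta> f m (map (cls T X m) ts) = cls T X (m + depth (Sig T) f) (App \<eta> f ts)"
proof -
  \<comment> \<open>With the prefix held fixed, this settles pure and free operations. A bound
    operation must also compare representatives under different binders.\<close>
  have the: "(THE C. \<exists>us\<in>car (pow_nom (arity (Sig T) f) (Trm m)).
        map (cls T X m) ts = map (cls T X m) us \<and> C = cls T X (m + depth (Sig T) f) (App \<eta> f us)) =
      cls T X (m + depth (Sig T) f) (App \<eta> f ts)"
  proof (rule the_equality)
    fix C
    assume "\<exists>us\<in>car (pow_nom (arity (Sig T) f) (Trm m)).
      map (cls T X m) ts = map (cls T X m) us \<and> C = cls T X (m + depth (Sig T) f) (App \<eta> f us)"
    then obtain us where us: "length us = arity (Sig T) f" "set us \<subseteq> car (Trm m)"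
        "map (cls T X m) us = map (cls T X m) ts"
        and C: "C = cls T X (m + depth (Sig T) f) (App \<eta> f us)"
      by auto
    have "derivable T X (m + depth (Sig T) f) (App \<eta> f us) (App \<eta> f ts)"
      using f us(1) map_cls_eqD[OF us(2) ts(2) us(3)] by (rule derivable.cong)
    then show "C = cls T X (m + depth (Sig T) f) (App \<eta> f ts)"
      unfolding C using f ts us by (subst cls_eq_iff) (auto intro!: App_in_TermI)
  qed (use ts in auto)
  show ?thesis
  proof (cases \<eta>)
    case NoPfx
    then show ?thesis
      using the by (simp add: apply_op_def free_model_def Let_def del: pow_nom_simps)
  next
    case (Name a)
    then show ?thesis
      using the by (simp add: apply_op_def free_model_def Let_def del: pow_nom_simps)
  next
    case (Nu a)
    have "bound_op F f m (abs_class (pow_nom (arity (Sig T) f) (lev F m)) a (map (cls T X m) ts)) =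
      (THE C. \<exists>b. \<exists>us\<in>car (pow_nom (arity (Sig T) f) (Trm m)).
        abs_class (pow_nom (arity (Sig T) f) (lev F m)) a (map (cls T X m) ts) =
          abs_class (pow_nom (arity (Sig T) f) (lev F m)) b (map (cls T X m) us) \<and>
        C = cls T X (m + depth (Sig T) f) (App (Nu b) f us))"
      by (simp add: free_model_def Let_def)
    also have "\<dots> = cls T X (m + depth (Sig T) f) (App (Nu a) f ts)"
    proof (rule the_equality)
      fix C
      assume "\<exists>b. \<exists>us\<in>car (pow_nom (arity (Sig T) f) (Trm m)).
        abs_class (pow_nom (arity (Sig T) f) (lev F m)) a (map (cls T X m) ts) =
          abs_class (pow_nom (arity (Sig T) f) (lev F m)) b (map (cls T X m) us) \<and>
        C = cls T X (m + depth (Sig T) f) (App (Nu b) f us)"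
      then obtain b us where us: "length us = arity (Sig T) f" "set us \<subseteq> car (Trm m)"
          "abs_class (pow_nom (arity (Sig T) f) (lev F m)) a (map (cls T X m) ts) =
            abs_class (pow_nom (arity (Sig T) f) (lev F m)) b (map (cls T X m) us)"
          and C: "C = cls T X (m + depth (Sig T) f) (App (Nu b) f us)"
        by auto
      have "derivable T X (m + depth (Sig T) f) (App (Nu a) f ts) (App (Nu b) f us)"
        using f Nu ts us by (intro derivable_Nu) auto
      then show "C = cls T X (m + depth (Sig T) f) (App (Nu a) f ts)"
        unfolding C using f Nu ts us by (subst cls_eq_iff) (auto intro!: App_in_TermI derivable.symm)
    qed (use ts in \<open>auto intro!: exI[of _ a] bexI[of _ ts]\<close>)
    finally show ?thesis
      by (simp add: apply_op_def Nu)
  qed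
qed

end

section \<open>Evaluation\<close>

lemma enat_add_le_D: "enat (m + k) \<le> n \<Longrightarrow> enat m \<le> n"
  by (meson enat_ord_simps(1) le_add1 order_trans)

section \<open>Algebras and homomorphisms through one prefixed operation\<close>

lemma all_pfx: "(\<forall>\<eta>. P \<eta>) \<longleftrightarrow> P NoPfx \<and> (\<forall>a. P (Name a)) \<and> (\<forall>a. P (Nu a))"
  by (metis pfx.exhaust)

text \<open>Merging the three kinds of operations into \<open>apply_op\<close> lets later arguments
  treat one generic prefix. For binders this works because every abstraction is the class of a pair,
  on which \<open>act_abs_class\<close> computes the action.\<close>

lemma is_algebra_iff_apply_op:
  fixes A :: "('a::infinite, 'f, 'c) algebra"
  shows "is_algebra \<Sigma> n A \<longleftrightarrow> (\<forall>i. enat i \<le> n \<longrightarrow> nominal_set (lev A i)) \<and>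
    (\<forall>\<eta> f m xs \<pi>. op_pfx \<Sigma> \<eta> f \<longrightarrow> enat (m + depth \<Sigma> f) \<le> n \<longrightarrow>
      xs \<in> car (pow_nom (arity \<Sigma> f) (lev A m)) \<longrightarrow>
      apply_op \<Sigma> A \<eta> f m xs \<in> car (lev A (m + depth \<Sigma> f)) \<and>
      apply_op \<Sigma> A (pfx_act \<pi> \<eta>) f m (map (act (lev A m) \<pi>) xs) =
        act (lev A (m + depth \<Sigma> f)) \<pi> (apply_op \<Sigma> A \<eta> f m xs))" (is "_ \<longleftrightarrow> ?N \<and> ?R")
proof (cases ?N)
  case True
  have pure: "equivariant (pow_nom p (lev A m)) B f \<longleftrightarrow>
      (\<forall>xs \<pi>. xs \<in> car (pow_nom p (lev A m)) \<longrightarrow>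
        f xs \<in> car B \<and> f (map (act (lev A m) \<pi>) xs) = act B \<pi> (f xs))"
    for p m and B :: "('a, 'c) nomset" and f
    by (auto simp: equivariant_def)
  have free: "equivariant (prod_nom names (pow_nom p (lev A m))) B f \<longleftrightarrow>
      (\<forall>a xs \<pi>. xs \<in> car (pow_nom p (lev A m)) \<longrightarrow>
        f (a, xs) \<in> car B \<and> f (\<pi> \<langle>$\<rangle> a, map (act (lev A m) \<pi>) xs) = act B \<pi> (f (a, xs)))"
    for p m and B :: "('a, 'c) nomset" and f
    by (auto simp: equivariant_def prod_nom_def names_def)
  have bound: "equivariant (abs_nom (pow_nom p (lev A m))) B f \<longleftrightarrow>
      (\<forall>a xs \<pi>. xs \<in> car (pow_nom p (lev A m)) \<longrightarrow>
        f (abs_class (pow_nom p (lev A m)) a xs) \<in> car B \<and>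
        f (abs_class (pow_nom p (lev A m)) (\<pi> \<langle>$\<rangle> a) (map (act (lev A m) \<pi>) xs)) =
          act B \<pi> (f (abs_class (pow_nom p (lev A m)) a xs)))"
    if "enat (m + k) \<le> n" for p m k and B :: "('a, 'c) nomset" and f
  proof -
    have "nominal_set (pow_nom p (lev A m))"
      using True that enat_add_le_D nominal_set_pow by blast
    note act = act_abs_class[OF this]
    have ball: "(\<forall>C\<in>car (abs_nom (pow_nom p (lev A m))). Q C) \<longleftrightarrow>
        (\<forall>a xs. xs \<in> car (pow_nom p (lev A m)) \<longrightarrow> Q (abs_class (pow_nom p (lev A m)) a xs))" for Q
      unfolding car_abs_nom by blast
    show ?thesis
      unfolding equivariant_def ball by (simp add: act del: pow_nom_simps(1)) blast
  qed
  show ?thesis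
    unfolding is_algebra_def all_pfx
    using True by (simp add: apply_op_def pure free bound del: pow_nom_simps) blast
qed (auto simp: is_algebra_def simp del: pow_nom_simps)

lemma is_hom_iff_apply_op:
  "is_hom \<Sigma> n A B h \<longleftrightarrow> (\<forall>i. enat i \<le> n \<longrightarrow> equivariant (lev A i) (lev B i) (h i)) \<and>
    (\<forall>\<eta> f m xs. op_pfx \<Sigma> \<eta> f \<longrightarrow> enat (m + depth \<Sigma> f) \<le> n \<longrightarrow>
      xs \<in> car (pow_nom (arity \<Sigma> f) (lev A m)) \<longrightarrow>
      h (m + depth \<Sigma> f) (apply_op \<Sigma> A \<eta> f m xs) = apply_op \<Sigma> B \<eta> f m (map (h m) xs))"
  unfolding is_hom_def all_pfx by (simp add: apply_op_def del: pow_nom_simps) blast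

text \<open>With the depth written as a sum, the truncated subtraction in \<open>eval\<close> is
  exact and disappears; the raw equation is withdrawn from the simplifier afterwards.\<close>

lemma eval_App [simp]:
  "eval \<Sigma> A k \<iota> (App \<eta> f ts) (m + depth \<Sigma> f) =
    apply_op \<Sigma> A \<eta> f (k + m) (map (\<lambda>t. eval \<Sigma> A k \<iota> t m) ts)"
  by (simp add: comp_def)

declare eval.simps(2) [simp del]

text \<open>All operations respect the action, so evaluation inherits equivariance from the
  valuation. Soundness uses this to pull \<open>\<tau>\<close> out of an axiom instance and to
  transfer freshness from terms to values.\<close>

lemma equivariant_eval:
  fixes A :: "('a::infinite, 'f, 'c) algebra"
  assumes A: "is_algebra \<Sigma> n A" and \<iota>: "equivariant Y (lev A k) \<iota>" and n: "enat (k + m) \<le> n"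
  shows "equivariant (Term \<Sigma> m Y) (lev A (k + m)) (\<lambda>t. eval \<Sigma> A k \<iota> t m)"
proof -
  have "eval \<Sigma> A k \<iota> t m \<in> car (lev A (k + m)) \<and>
      eval \<Sigma> A k \<iota> (trm_act Y \<pi> t) m = act (lev A (k + m)) \<pi> (eval \<Sigma> A k \<iota> t m)"
    if "t \<in> car (Term \<Sigma> m Y)" for t \<pi>
    using that n
  proof (induction rule: Term_induct)
    case (Var x)
    then show ?case
      using \<iota> by (simp add: equivariant_def)
  next
    case (App \<eta> f ts m)
    let ?xs = "map (\<lambda>t. eval \<Sigma> A k \<iota> t m) ts"
    have n: "enat (k + m + depth \<Sigma> f) \<le> n"
      using App.prems by (simp add: ac_simps)
    then have "enat (k + m) \<le> n"
      by (rule enat_add_le_D)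
    note IH = App.IH[OF _ this]
    have "?xs \<in> car (pow_nom (arity \<Sigma> f) (lev A (k + m)))"
      using IH App.hyps by auto
    moreover have "map (\<lambda>t. eval \<Sigma> A k \<iota> t m) (map (trm_act Y \<pi>) ts) = map (act (lev A (k + m)) \<pi>) ?xs"
      using IH by simp
    ultimately show ?case
      using A App.hyps n unfolding is_algebra_iff_apply_op
      by (simp add: add.assoc[symmetric] del: map_map pow_nom_simps)
  qed
  then show ?thesis
    by (simp add: equivariant_def)
qed

text \<open>The substitution lemma. Evaluating the terms \<open>\<sigma> y\<close> at depth
  \<open>l\<close> yields a valuation in level \<open>k + l\<close>, hence the shifted base level on
  the right.\<close>

lemma eval_subst:
  assumes "t \<in> car (Term \<Sigma> m Y)"
  shows "eval \<Sigma> A k \<iota> (subst \<sigma> t) (m + l) = eval \<Sigma> A (k + l) (\<lambda>y. eval \<Sigma> A k \<iota> (\<sigma> y) l) t m"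
  using assms
proof (induction rule: Term_induct)
  case (App \<eta> f ts m)
  have "eval \<Sigma> A k \<iota> (subst \<sigma> (App \<eta> f ts)) (m + depth \<Sigma> f + l) =
      eval \<Sigma> A k \<iota> (App \<eta> f (map (subst \<sigma>) ts)) (m + l + depth \<Sigma> f)"
    by (simp add: ac_simps)
  also have "\<dots> = apply_op \<Sigma> A \<eta> f (k + (m + l))
      (map (\<lambda>t. eval \<Sigma> A (k + l) (\<lambda>y. eval \<Sigma> A k \<iota> (\<sigma> y) l) t m) ts)"
    using App by (simp add: comp_def cong: map_cong)
  finally show ?case
    by (simp add: ac_simps)
qed simp

section \<open>The term model satisfies the axioms\<close>

context nominal_theory
begin

lemma represented_ops_free_model: "represented_ops T n X F"
proof -
  have *: "apply_op (Sig T) F \<eta> f m (map (cls T X m) ts) = cls T X (m + depth (Sig T) f) (App \<eta> f ts)"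
    if "op_pfx (Sig T) \<eta> f" "ts \<in> car (pow_nom (arity (Sig T) f) (Trm m))" for \<eta> f m ts
    using apply_op_free_model that by simp
  show ?thesis
    unfolding represented_ops_def
    using *[of NoPfx] *[of "Name _"] *[of "Nu _"] by (simp add: apply_op_def)
qed

lemma is_algebra_free_model: "is_algebra (Sig T) n F"
  unfolding is_algebra_iff_apply_op
proof (intro conjI allI impI nominal_set_lev)
  fix \<eta> :: "'a pfx" and f m Cs \<pi>
  assume f: "op_pfx (Sig T) \<eta> f" and "Cs \<in> car (pow_nom (arity (Sig T) f) (lev F m))"
  then obtain ts where ts: "length ts = arity (Sig T) f" "set ts \<subseteq> car (Trm m)"
      and Cs: "Cs = map (cls T X m) ts"
    by (metis pow_lev_cases)
  have App: "App \<eta> f ts \<in> car (Trm (m + depth (Sig T) f))"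
    using f ts by (rule App_in_TermI)
  then show "apply_op (Sig T) F \<eta> f m Cs \<in> car (lev F (m + depth (Sig T) f))"
    using apply_op_free_model[OF f ts] by (simp add: Cs car_lev)
  have "apply_op (Sig T) F (pfx_act \<pi> \<eta>) f m (map (cls T X m) (map (trm_act X \<pi>) ts)) =
      cls T X (m + depth (Sig T) f) (App (pfx_act \<pi> \<eta>) f (map (trm_act X \<pi>) ts))"
    using f ts by (intro apply_op_free_model) (auto intro: trm_act_Trm)
  then show "apply_op (Sig T) F (pfx_act \<pi> \<eta>) f m (map (act (lev F m) \<pi>) Cs) =
      act (lev F (m + depth (Sig T) f)) \<pi> (apply_op (Sig T) F \<eta> f m Cs)"
    unfolding Cs map_act_cls[OF ts(2)] apply_op_free_model[OF f ts] act_lev_cls[OF App] by simp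
qed

text \<open>Since each operation of the quotient is computed on representatives, evaluation there is
  substitution of representatives followed by passage to the class.\<close>

lemma eval_free_model:
  assumes "\<And>y. y \<in> car Y \<Longrightarrow> \<sigma> y \<in> car (Trm k) \<and> \<iota> y = cls T X k (\<sigma> y)"
    and "t \<in> car (Term (Sig T) m Y)"
  shows "eval (Sig T) F k \<iota> t m = cls T X (m + k) (subst \<sigma> t)"
  using assms(2)
proof (induction rule: Term_induct)
  case (App \<eta> f ts m)
  have *: "map (\<lambda>t. eval (Sig T) F k \<iota> t m) ts = map (cls T X (k + m)) (map (subst \<sigma>) ts)"
    using App.IH by (simp add: add.commute)
  have "set (map (subst \<sigma>) ts) \<subseteq> car (Trm (k + m))"
    using App.hyps assms(1) subst_in_Term[of Y \<sigma> "Sig T" k X _ m] by (auto simp: add.commute)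
  then show ?case
    using App.hyps apply_op_free_model[of \<eta> f "map (subst \<sigma>) ts" "k + m"]
    unfolding eval_App * by (simp add: ac_simps)
qed (simp add: assms(1))

lemma is_model_free_model: "is_model T n F"
  unfolding is_model_def satisfies_def
proof (intro conjI ballI allI impI is_algebra_free_model)
  fix e k \<iota>
  assume e: "e \<in> Axs T" and \<iota>: "equivariant (eq_ctx e) (lev F k) \<iota>"
  have "\<forall>y\<in>car (eq_ctx e). \<exists>t. t \<in> car (Trm k) \<and> \<iota> y = cls T X k t"
    using \<iota> by (auto simp: equivariant_def car_lev)
  \<comment> \<open>The representatives are chosen one by one, so \<open>\<sigma>\<close> need not
    commute with the action strictly; it does so up to derivable equality.\<close>
  then obtain \<sigma> where \<sigma>: "\<And>y. y \<in> car (eq_ctx e) \<Longrightarrow> \<sigma> y \<in> car (Trm k) \<and> \<iota> y = cls T X k (\<sigma> y)"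
    by metis
  have "derivable T X k (trm_act X \<pi> (\<sigma> y)) (\<sigma> (act (eq_ctx e) \<pi> y))" if y: "y \<in> car (eq_ctx e)" for \<pi> y
  proof -
    have y': "act (eq_ctx e) \<pi> y \<in> car (eq_ctx e)"
      using axiomD(1)[OF e] y by (rule act_in_car)
    have "cls T X k (trm_act X \<pi> (\<sigma> y)) = \<iota> (act (eq_ctx e) \<pi> y)"
      using \<iota> y \<sigma>[OF y] by (simp add: equivariant_def act_lev_cls)
    then show ?thesis
      using \<sigma>[OF y] \<sigma>[OF y'] by (simp add: cls_eq_iff trm_act_Trm)
  qed
  \<comment> \<open>The rule \<open>ax\<close> is taken at the identity permutation, whose action is
    removed next.\<close>
  then have "derivable T X (eq_depth e + k)
      (subst \<sigma> (trm_act (eq_ctx e) 1 (eq_lhs e))) (subst \<sigma> (trm_act (eq_ctx e) 1 (eq_rhs e)))"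
    using e \<sigma> by (intro derivable.ax) auto
  moreover have "trm_act (eq_ctx e) 1 t = t" if "t \<in> car (Term (Sig T) (eq_depth e) (eq_ctx e))" for t
    using act_one[OF nominal_set_Term[OF axiomD(1)[OF e]] that] by simp
  ultimately have "derivable T X (eq_depth e + k) (subst \<sigma> (eq_lhs e)) (subst \<sigma> (eq_rhs e))"
    using axiomD(2,3)[OF e] by simp
  then show "eval (Sig T) F k \<iota> (eq_lhs e) (eq_depth e) = eval (Sig T) F k \<iota> (eq_rhs e) (eq_depth e)"
    using axiomD(2,3)[OF e] derivable_in_Term
    by (simp add: eval_free_model[where Y = "eq_ctx e" and \<sigma> = \<sigma>] \<sigma> cls_eq_iff)
qed

section \<open>Soundness and freeness\<close>

text \<open>Rule induction at the fixed valuation \<open>g\<close>. In the case of \<open>ax\<close>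
  the axiom is invoked in level \<open>l\<close>, with the valuation obtained by evaluating the
  substitution; in the case of \<open>perm\<close> the arguments form equal abstractions by
  \<open>abs_class_swap\<close>.\<close>

lemma derivable_sound:
  fixes A :: "('a, 'f, 'c) algebra"
  assumes A: "is_model T n A" and g: "equivariant X (lev A 0) g"
    and "derivable T X m t u" and "enat m \<le> n"
  shows "eval (Sig T) A 0 g t m = eval (Sig T) A 0 g u m"
  using assms(3,4)
proof (induction rule: derivable.induct)
  case (cong \<eta> f ts m us)
  have "enat m \<le> n"
    using cong.prems by (rule enat_add_le_D)
  then have "map (\<lambda>t. eval (Sig T) A 0 g t m) ts = map (\<lambda>t. eval (Sig T) A 0 g t m) us"
    using cong by (auto simp: list_all2_conv_all_nth intro: nth_equalityI)
  then show ?case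
    by simp
next
  case (ax e \<sigma> l \<tau>)
  let ?Y = "eq_ctx e" and ?\<iota> = "\<lambda>y. eval (Sig T) A 0 g (\<sigma> y) l"
  note e = axiomD[OF ax(1)]
  have alg: "is_algebra (Sig T) n A"
    using A by (simp add: is_model_def)
  have n: "enat (l + eq_depth e) \<le> n"
    using ax.prems by (simp add: add.commute)
  then have l: "enat (0 + l) \<le> n"
    using enat_add_le_D by simp
  \<comment> \<open>The induction hypothesis for the side condition of \<open>ax\<close> turns
    derivable equality into equality of values, which makes \<open>?\<iota>\<close> strictly
    equivariant.\<close>
  have "?\<iota> (act ?Y \<pi> y) = act (lev A l) \<pi> (?\<iota> y)" "?\<iota> y \<in> car (lev A l)" if "y \<in> car ?Y" for \<pi> y
    using ax that l equivariant_eval[OF alg g l] by (simp_all add: equivariant_def)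
  then have \<iota>: "equivariant ?Y (lev A l) ?\<iota>"
    by (simp add: equivariant_def)
  then have "eval (Sig T) A l ?\<iota> (eq_lhs e) (eq_depth e) = eval (Sig T) A l ?\<iota> (eq_rhs e) (eq_depth e)"
    using A ax(1) n by (auto simp: is_model_def satisfies_def)
  \<comment> \<open>Equivariance of evaluation moves \<open>\<tau>\<close> outside, where it acts
    alike on both sides of the axiom.\<close>
  moreover have "eval (Sig T) A 0 g (subst \<sigma> (trm_act ?Y \<tau> t)) (eq_depth e + l) =
      act (lev A (l + eq_depth e)) \<tau> (eval (Sig T) A l ?\<iota> t (eq_depth e))"
    if "t \<in> car (Term (Sig T) (eq_depth e) ?Y)" for t
    using eval_subst[OF trm_act_in_Term[OF e(1) that], of A 0 g \<sigma> \<tau> l]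
      equivariant_eval[OF alg \<iota> n] that by (simp add: equivariant_def)
  ultimately show ?case
    using e by simp
next
  case (perm h ts a b us m)
  let ?ev = "\<lambda>t. eval (Sig T) A 0 g t m" and ?P = "pow_nom (arity (Sig T) h) (lev A m)"
  have alg: "is_algebra (Sig T) n A"
    using A by (simp add: is_model_def)
  have m: "enat (0 + m) \<le> n"
    using perm.prems enat_add_le_D by simp
  have lev: "nominal_set (lev A m)"
    using alg m by (simp add: is_algebra_def)
  have ev: "equivariant (Trm m) (lev A m) ?ev"
    using equivariant_eval[OF alg g m] by simp
  have us: "map ?ev us \<in> car ?P"
    using perm.hyps list_all2_lengthD[OF perm.IH] ev by (auto simp: equivariant_def)
  have "map ?ev ts = act ?P \<langle>a \<leftrightarrow> b\<rangle> (map ?ev us)"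
  proof (rule nth_equalityI)
    fix i
    assume "i < length (map ?ev ts)"
    then show "map ?ev ts ! i = act ?P \<langle>a \<leftrightarrow> b\<rangle> (map ?ev us) ! i"
      using perm m ev by (simp add: list_all2_conv_all_nth equivariant_def)
  qed (use list_all2_lengthD[OF perm.IH] in simp)
  \<comment> \<open>The name \<open>a\<close> is fresh for the terms, hence for their values and for
    the tuple of these.\<close>
  moreover have "fresh ?P a (map ?ev us)"
    using us perm.hyps fresh_equivariant_image[OF nominal_Trm lev ev]
    by (intro fresh_pow[OF lev us]) auto
  ultimately have "abs_class ?P a (map ?ev ts) = abs_class ?P b (map ?ev us)"
    using abs_class_swap[OF nominal_set_pow[OF lev] us] perm.hyps by simp
  then show ?case
    by (simp add: apply_op_def)
qed auto

text \<open>Every class arises from variables by the operations, so commuting with the operations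
  forces the value to be the evaluation of a representative. Uniqueness comes from this
  formula.\<close>

lemma hom_on_cls:
  fixes A :: "('a, 'f, 'c) algebra"
  assumes h: "is_hom (Sig T) n F A h" and g: "\<And>x. x \<in> car X \<Longrightarrow> h 0 (unit_map T X x) = g x"
    and "t \<in> car (Trm m)" "enat m \<le> n"
  shows "h m (cls T X m t) = eval (Sig T) A 0 g t m"
  using assms(3,4)
proof (induction rule: Term_induct)
  case (Var x)
  then show ?case
    using g by (simp add: unit_map_def)
next
  case (App \<eta> f ts m)
  have m: "enat m \<le> n"
    using App.prems by (rule enat_add_le_D)
  have "map (cls T X m) ts \<in> car (pow_nom (arity (Sig T) f) (lev F m))"
    using App.hyps by (auto simp: car_lev)
  then have "h (m + depth (Sig T) f) (apply_op (Sig T) F \<eta> f m (map (cls T X m) ts)) =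
      apply_op (Sig T) A \<eta> f m (map (h m) (map (cls T X m) ts))"
    using h App.hyps(1) App.prems unfolding is_hom_iff_apply_op by blast
  moreover have "map (h m) (map (cls T X m) ts) = map (\<lambda>t. eval (Sig T) A 0 g t m) ts"
    using App.IH m by simp
  ultimately show ?case
    using apply_op_free_model[OF App.hyps] by (simp del: map_map map_eq_conv)
qed

lemma ex_hom:
  fixes A :: "('a, 'f, 'c) algebra"
  assumes A: "is_model T n A" and g: "equivariant X (lev A 0) g"
  shows "\<exists>h. is_hom (Sig T) n F A h \<and> (\<forall>x\<in>car X. h 0 (unit_map T X x) = g x)"
proof -
  \<comment> \<open>Some representative is evaluated; soundness makes the value independent of the
    choice at all levels up to \<open>n\<close>.\<close>
  define h where "h m C = eval (Sig T) A 0 g (SOME t. t \<in> car (Trm m) \<and> C = cls T X m t) m" for m C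
  have h: "h m (cls T X m t) = eval (Sig T) A 0 g t m" if t: "t \<in> car (Trm m)" and m: "enat m \<le> n" for m t
  proof -
    let ?u = "SOME u. u \<in> car (Trm m) \<and> cls T X m t = cls T X m u"
    have "?u \<in> car (Trm m) \<and> cls T X m t = cls T X m ?u"
      by (rule someI[of _ t]) (simp add: t)
    then have "derivable T X m t ?u"
      using cls_eq_iff t by blast
    then show ?thesis
      using derivable_sound[OF A g _ m] by (simp add: h_def)
  qed
  have alg: "is_algebra (Sig T) n A"
    using A by (simp add: is_model_def)
  have "is_hom (Sig T) n F A h"
    unfolding is_hom_iff_apply_op
  proof (intro conjI allI impI)
    fix i
    assume i: "enat i \<le> n"
    then show "equivariant (lev F i) (lev A i) (h i)"
      using equivariant_eval[OF alg g, of i]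
      by (auto simp: equivariant_def car_lev act_lev_cls h trm_act_Trm)
  next
    fix \<eta> :: "'a pfx" and f m Cs
    assume f: "op_pfx (Sig T) \<eta> f" and n: "enat (m + depth (Sig T) f) \<le> n"
      and "Cs \<in> car (pow_nom (arity (Sig T) f) (lev F m))"
    then obtain ts where ts: "length ts = arity (Sig T) f" "set ts \<subseteq> car (Trm m)"
        and Cs: "Cs = map (cls T X m) ts"
      by (metis pow_lev_cases)
    have "map (h m) Cs = map (\<lambda>t. eval (Sig T) A 0 g t m) ts"
      using ts(2) enat_add_le_D[OF n] by (auto simp: Cs h)
    then show "h (m + depth (Sig T) f) (apply_op (Sig T) F \<eta> f m Cs) =
        apply_op (Sig T) A \<eta> f m (map (h m) Cs)"
      using n by (simp add: Cs apply_op_free_model[OF f ts] h App_in_TermI f ts del: map_map map_eq_conv)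
  qed
  moreover have "\<forall>x\<in>car X. h 0 (unit_map T X x) = g x"
    by (simp add: unit_map_def h zero_enat_def[symmetric])
  ultimately show ?thesis
    by blast
qed

end

text \<open>Homomorphisms are total functions here, so uniqueness is asserted on the carriers of
  levels up to \<open>n\<close>, where their values are constrained. The first conjunct records that
  the operations described by \<open>THE\<close> are well defined.\<close>

theorem theorem2:
  fixes T :: "('a::{countable,infinite}, 'f, 'y) graded_theory"
    and n :: enat
    and X :: "('a, 'x) nomset"
  assumes "is_graded_theory T"
    and "nominal_set X"
  shows "represented_ops T n X (free_model T X)
    \<and> is_model T n (free_model T X)
    \<and> equivariant X (lev (free_model T X) 0) (unit_map T X)
    \<and> (\<forall>(A :: ('a, 'f, 'c) algebra) g.
         is_model T n A \<longrightarrow> equivariant X (lev A 0) g \<longrightarrow>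
         (\<exists>h. is_hom (Sig T) n (free_model T X) A h \<and> (\<forall>x\<in>car X. h 0 (unit_map T X x) = g x) \<and>
            (\<forall>h'. is_hom (Sig T) n (free_model T X) A h' \<and>
                  (\<forall>x\<in>car X. h' 0 (unit_map T X x) = g x) \<longrightarrow>
                  (\<forall>i. enat i \<le> n \<longrightarrow> (\<forall>C\<in>car (lev (free_model T X) i). h' i C = h i C)))))"
proof -
  interpret nominal_theory T X
    using assms by unfold_locales
  \<comment> \<open>Both homomorphisms agree with evaluation under the same valuation
    \<open>g\<close>.\<close>
  have unique: "h' i C = h i C"
    if "is_hom (Sig T) n F A h" "\<forall>x\<in>car X. h 0 (unit_map T X x) = g x"
      "is_hom (Sig T) n F A h'" "\<forall>x\<in>car X. h' 0 (unit_map T X x) = g x"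
      "enat i \<le> n" "C \<in> car (lev F i)"
    for A :: "('a, 'f, 'c) algebra" and g h h' i C
    using that hom_on_cls[of n A h g] hom_on_cls[of n A h' g] by (auto simp: car_lev)
  show ?thesis
  proof (intro conjI allI impI represented_ops_free_model is_model_free_model equivariant_unit_map)
    fix A :: "('a, 'f, 'c) algebra" and g
    assume "is_model T n A" "equivariant X (lev A 0) g"
    then obtain h where h: "is_hom (Sig T) n F A h" "\<forall>x\<in>car X. h 0 (unit_map T X x) = g x"
      using ex_hom by blast
    show "\<exists>h. is_hom (Sig T) n F A h \<and> (\<forall>x\<in>car X. h 0 (unit_map T X x) = g x) \<and>
        (\<forall>h'. is_hom (Sig T) n F A h' \<and> (\<forall>x\<in>car X. h' 0 (unit_map T X x) = g x) \<longrightarrow>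
          (\<forall>i. enat i \<le> n \<longrightarrow> (\<forall>C\<in>car (lev F i). h' i C = h i C)))"
    proof (rule exI[of _ h], intro conjI allI impI ballI h)
      fix h' i C
      assume "is_hom (Sig T) n F A h' \<and> (\<forall>x\<in>car X. h' 0 (unit_map T X x) = g x)"
        and "enat i \<le> n" "C \<in> car (lev F i)"
      then show "h' i C = h i C"
        using unique[OF h, of h' i C] by simp
    qed (use h(2) in simp)
  qed
qed

end
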